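(* Let $d\ge1$ be fixed. A nonzero normalized state $H$ with $N(H)\le n$ (at most $n$ active vertices) and a pivot class $(a,r)$ with $H_{a,r}>0$ has $O_d(n^d)$ aggregated transitions. Moreover, those transitions and their integer weights can be generated with polynomial overhead in $n$ per transition.
   Context: A normalized state is a finitely supported array $H=(H_{a,r})_{a\ge1,\,1\le r\le d}$ of nonnegative integers, and $N(H)=\sum_{a,r}aH_{a,r}$. $O_d$ means that the implied constant depends only on $d$. For $a\ge1$ let $P_a(x)=(1+x^2)^{\lfloor(a-1)/2\rfloor}(1+x)^{\varepsilon_a}$ with $\varepsilon_a=1$ for $a$ even and $0$ for $a$ odd, and $I_a(u)=[x^u]P_a(x)$. Given $H$ and $(a,r)$ with $H_{a,r}>0$, let $h_{b,s}=H_{b,s}-1$ if $(b,s)=(a,r)$ and $h_{b,s}=H_{b,s}$ otherwise. For $b\ge1$, $1\le s\le d$ let $g_{ab}=\gcd(a,b)$, $\alpha_{ab}=b/g_{ab}$, $\beta_{ab}=a/g_{ab}$ and $K_{a,r;b,s}=\min\{g_{ab},\lfloor r/\alpha_{ab}\rfloor,\lfloor s/\beta_{ab}\rfloor\}$. $\mathcal{A}(H,a,r,u)$ is the set of families $\nu=(\nu_{b,s,k})_{b\ge1,\,1\le s\le d,\,0\le k\le K_{a,r;b,s}}$ of nonnegative integers with $$\sum_{k}\nu_{b,s,k}=h_{b,s}\text{ for all }(b,s),\qquad u+\sum_{b,s,k}k\,\alpha_{ab}\,\nu_{b,s,k}=r.$$ An aggregated transition from $H$ (with pivot class $(a,r)$)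 is a pair $(u,\nu)$ with $0\le u\le r$ and $\nu\in\mathcal{A}(H,a,r,u)$. Its weight is the integer $I_a(u)\prod_{b,s}W_{b,s}(\nu)$, where $$W_{b,s}(\nu)=\frac{h_{b,s}!}{\prod_k\nu_{b,s,k}!}\prod_k\binom{g_{ab}}{k}^{\nu_{b,s,k}},$$ and it leads to the state $H^\nu$, where $H^\nu_{b,t}$ ($b\ge1$, $1\le t\le d$) is the sum of $\nu_{b,s,k}$ over all $(s,k)$ with $s-k\beta_{ab}=t$. These are the terms of the recurrence $\Phi(H)=\sum_{u=0}^{r}I_a(u)\sum_{\nu\in\mathcal{A}(H,a,r,u)}\bigl(\prod_{b,s}W_{b,s}(\nu)\bigr)\Phi(H^\nu)$. *)

theory Defs
  imports
    "HOL-Computational_Algebra.Polynomial"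
    "HOL-Library.Discrete_Functions"
begin

section \<open>States and aggregated transitions\<close>

text \<open>
  An array indexed by $a \ge 1$, $1 \le r \le d$ is a total function on pairs that vanishes
  outside the index range; likewise for the families indexed by $(b,s,k)$ below.
\<close>

type_synonym state = "nat \<times> nat \<Rightarrow> nat"
type_synonym family = "nat \<times> nat \<times> nat \<Rightarrow> nat"

definition supp :: "('k \<Rightarrow> nat) \<Rightarrow> 'k set" where
  "supp f = {x. f x \<noteq> 0}"

definition normalized :: "nat \<Rightarrow> state \<Rightarrow> bool" where
  "normalized d H \<longleftrightarrow> finite (supp H) \<and> (\<forall>(a, r) \<in> supp H. 1 \<le> a \<and> 1 \<le> r \<and> r \<le> d)"

definition active_vertices :: "state \<Rightarrow> nat" where
  "active_vertices H = (\<Sum>(a, r) \<in> supp H. a * H (a, r))"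

definition P_poly :: "nat \<Rightarrow> nat poly" where
  "P_poly a = [:1, 0, 1:] ^ ((a - 1) div 2) * [:1, 1:] ^ (if even a then 1 else 0)"

definition I_coeff :: "nat \<Rightarrow> nat \<Rightarrow> nat" where
  "I_coeff a u = coeff (P_poly a) u"

definition remaining :: "state \<Rightarrow> nat \<Rightarrow> nat \<Rightarrow> state" where
  "remaining H a r = H((a, r) := H (a, r) - 1)"

definition alpha :: "nat \<Rightarrow> nat \<Rightarrow> nat" where
  "alpha a b = b div gcd a b"

definition beta :: "nat \<Rightarrow> nat \<Rightarrow> nat" where
  "beta a b = a div gcd a b"

definition K_max :: "nat \<Rightarrow> nat \<Rightarrow> nat \<Rightarrow> nat \<Rightarrow> nat" where
  "K_max a r b s = min (gcd a b) (min (r div alpha a b) (s div beta a b))"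

text \<open>
  The row sums force \<open>\<nu> (b, s, k) = 0\<close> unless \<open>(b, s)\<close> lies in the finite support of the
  remaining state, so the sum over all \<open>(b, s, k)\<close> is taken over that support only.
\<close>

definition families :: "nat \<Rightarrow> state \<Rightarrow> nat \<Rightarrow> nat \<Rightarrow> nat \<Rightarrow> family set" where
  "families d H a r u =
    {\<nu>. (\<forall>(b, s, k) \<in> supp \<nu>. 1 \<le> b \<and> 1 \<le> s \<and> s \<le> d \<and> k \<le> K_max a r b s)
       \<and> (\<forall>b \<ge> 1. \<forall>s \<in> {1..d}. (\<Sum>k \<le> K_max a r b s. \<nu> (b, s, k)) = remaining H a r (b, s))
       \<and> u + (\<Sum>(b, s) \<in> supp (remaining H a r). \<Sum>k \<le> K_max a r b s.
               k * alpha a b * \<nu> (b, s, k)) = r}"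

definition transitions :: "nat \<Rightarrow> state \<Rightarrow> nat \<Rightarrow> nat \<Rightarrow> (nat \<times> family) set" where
  "transitions d H a r = {(u, \<nu>). u \<le> r \<and> \<nu> \<in> families d H a r u}"

text \<open>The division in the following definition is exact, by the lemma after it.\<close>

definition W_factor :: "state \<Rightarrow> nat \<Rightarrow> nat \<Rightarrow> family \<Rightarrow> nat \<Rightarrow> nat \<Rightarrow> nat" where
  "W_factor H a r \<nu> b s =
     (fact (remaining H a r (b, s)) div (\<Prod>k \<le> K_max a r b s. fact (\<nu> (b, s, k))))
     * (\<Prod>k \<le> K_max a r b s. (gcd a b choose k) ^ \<nu> (b, s, k))"

lemma prod_fact_dvd_fact_sum:
  fixes f :: "nat \<Rightarrow> nat"
  shows "(\<Prod>k \<le> m. fact (f k)) dvd (fact (\<Sum>k \<le> m. f k) :: nat)"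
proof (induction m)
  case 0
  show ?case by simp
next
  case (Suc m)
  have "(\<Prod>k \<le> Suc m. fact (f k) :: nat) dvd fact (\<Sum>k \<le> m. f k) * fact (f (Suc m))"
    using Suc.IH by (simp add: mult_dvd_mono)
  also have "\<dots> dvd fact ((\<Sum>k \<le> m. f k) + f (Suc m))"
    by (rule fact_fact_dvd_fact)
  finally show ?case by simp
qed

text \<open>
  For \<open>\<nu> \<in> families d H a r u\<close> all factors with \<open>(b, s)\<close> outside the support of the remaining
  state equal \<open>1\<close>, so the product over all \<open>(b, s)\<close> is a product over that support.
\<close>

definition weight :: "state \<Rightarrow> nat \<Rightarrow> nat \<Rightarrow> nat \<Rightarrow> family \<Rightarrow> nat" where
  "weight H a r u \<nu> =
     I_coeff a u * (\<Prod>(b, s) \<in> supp (remaining H a r). W_factor H a r \<nu> b s)"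


section \<open>Model of computation\<close>

text \<open>
  Programs are finite lists of mutually recursive first-order functions (call by value) over
  binary trees whose leaves are natural numbers.  The size of a value is its bit size: one per
  inner node plus the number of binary digits of every leaf (one digit for \<open>0\<close>).
  Every evaluation step is charged the full size of the value it produces, i.e. copying and
  big-number arithmetic are not free.  The operands of an arithmetic operation have themselves
  been charged for, so a Turing machine simulates an evaluation of cost \<open>t\<close> on input of size \<open>m\<close>
  in time polynomial in \<open>t + m\<close>, and ``polynomial time'' has its usual meaning.
\<close>

datatype val = Leaf nat | Node val val

primrec val_size :: "val \<Rightarrow> nat" where
  "val_size (Leaf n) = floor_log n + 1"
| "val_size (Node v w) = 1 + val_size v + val_size w"

datatype arith = Add | Sub | Mul | Div | Mod | Less | Equal

primrec arith_op :: "arith \<Rightarrow> nat \<Rightarrow> nat \<Rightarrow> nat" where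
  "arith_op Add x y = x + y"
| "arith_op Sub x y = x - y"
| "arith_op Mul x y = x * y"
| "arith_op Div x y = x div y"
| "arith_op Mod x y = x mod y"
| "arith_op Less x y = of_bool (x < y)"
| "arith_op Equal x y = of_bool (x = y)"

text \<open>
  \<open>Var i\<close> is a de Bruijn index into the environment: the arguments of the current function,
  preceded by the locally bound values (\<open>Bind\<close> is a local definition).
  \<open>Cond\<close> branches on whether the first expression evaluates to \<open>Leaf 0\<close>.
  \<open>Call f es\<close> applies the \<open>f\<close>-th function of the program.
\<close>

datatype expr =
    Var nat
  | Lit nat
  | Arith arith expr expr
  | Join expr expr
  | First expr
  | Second expr
  | Is_Node expr
  | Cond expr expr expr
  | Bind expr expr
  | Call nat "expr list"

type_synonym program = "expr list"

text \<open>
  \<open>eval P \<rho> e v t\<close>: in program \<open>P\<close> and environment \<open>\<rho>\<close>, the expression \<open>e\<close> evaluates to \<open>v\<close> at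
  cost \<open>t\<close>.
\<close>

inductive
  eval :: "program \<Rightarrow> val list \<Rightarrow> expr \<Rightarrow> val \<Rightarrow> nat \<Rightarrow> bool" and
  evals :: "program \<Rightarrow> val list \<Rightarrow> expr list \<Rightarrow> val list \<Rightarrow> nat \<Rightarrow> bool"
  for P :: program
where
  Var: "i < length \<rho> \<Longrightarrow> eval P \<rho> (Var i) (\<rho> ! i) (val_size (\<rho> ! i))"
| Lit: "eval P \<rho> (Lit n) (Leaf n) (val_size (Leaf n))"
| Arith: "\<lbrakk>eval P \<rho> e1 (Leaf x) t1; eval P \<rho> e2 (Leaf y) t2; v = Leaf (arith_op f x y)\<rbrakk>
    \<Longrightarrow> eval P \<rho> (Arith f e1 e2) v (t1 + t2 + val_size v)"
| Join: "\<lbrakk>eval P \<rho> e1 v t1; eval P \<rho> e2 w t2\<rbrakk>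
    \<Longrightarrow> eval P \<rho> (Join e1 e2) (Node v w) (t1 + t2 + val_size (Node v w))"
| First: "eval P \<rho> e (Node v w) t \<Longrightarrow> eval P \<rho> (First e) v (t + val_size v)"
| Second: "eval P \<rho> e (Node v w) t \<Longrightarrow> eval P \<rho> (Second e) w (t + val_size w)"
| Is_Node_Leaf: "eval P \<rho> e (Leaf n) t \<Longrightarrow> eval P \<rho> (Is_Node e) (Leaf 0) (t + val_size (Leaf 0))"
| Is_Node_Node: "eval P \<rho> e (Node v w) t
    \<Longrightarrow> eval P \<rho> (Is_Node e) (Leaf 1) (t + val_size (Leaf 1))"
| Cond_True: "\<lbrakk>eval P \<rho> e1 b t1; b \<noteq> Leaf 0; eval P \<rho> e2 v t2\<rbrakk>
    \<Longrightarrow> eval P \<rho> (Cond e1 e2 e3) v (t1 + t2 + val_size v)"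
| Cond_False: "\<lbrakk>eval P \<rho> e1 (Leaf 0) t1; eval P \<rho> e3 v t2\<rbrakk>
    \<Longrightarrow> eval P \<rho> (Cond e1 e2 e3) v (t1 + t2 + val_size v)"
| Bind: "\<lbrakk>eval P \<rho> e1 w t1; eval P (w # \<rho>) e2 v t2\<rbrakk>
    \<Longrightarrow> eval P \<rho> (Bind e1 e2) v (t1 + t2 + val_size v)"
| Call: "\<lbrakk>evals P \<rho> es vs t1; f < length P; eval P vs (P ! f) v t2\<rbrakk>
    \<Longrightarrow> eval P \<rho> (Call f es) v (t1 + t2 + val_size v)"
| Nil: "evals P \<rho> [] [] 0"
| Cons: "\<lbrakk>eval P \<rho> e v t1; evals P \<rho> es vs t2\<rbrakk> \<Longrightarrow> evals P \<rho> (e # es) (v # vs) (t1 + t2)"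

text \<open>Evaluation is deterministic, so a program run has a well-defined result and cost.\<close>

inductive_cases eval_elims:
  "eval P \<rho> (Var i) v t" "eval P \<rho> (Lit n) v t" "eval P \<rho> (Arith f e1 e2) v t"
  "eval P \<rho> (Join e1 e2) v t" "eval P \<rho> (First e) v t" "eval P \<rho> (Second e) v t"
  "eval P \<rho> (Is_Node e) v t" "eval P \<rho> (Cond e1 e2 e3) v t" "eval P \<rho> (Bind e1 e2) v t"
  "eval P \<rho> (Call f es) v t" "evals P \<rho> [] vs t" "evals P \<rho> (e # es) vs t"

lemma eval_deterministic:
  "eval P \<rho> e v t \<Longrightarrow> (\<And>v' t'. eval P \<rho> e v' t' \<Longrightarrow> v' = v \<and> t' = t)"
  "evals P \<rho> es vs t \<Longrightarrow> (\<And>vs' t'. evals P \<rho> es vs' t' \<Longrightarrow> vs' = vs \<and> t' = t)"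
proof (induction rule: eval_evals.inducts)
  case Var
  then show ?case by (auto elim: eval_elims)
next
  case Lit
  then show ?case by (auto elim: eval_elims)
next
  case Arith
  from Arith.prems Arith.hyps show ?case
    by (auto elim!: eval_elims dest!: Arith.IH(2) Arith.IH(4))
next
  case Join
  from Join.prems show ?case by (auto elim!: eval_elims dest!: Join.IH(2) Join.IH(4))
next
  case First
  from First.prems show ?case by (auto elim!: eval_elims dest!: First.IH(2))
next
  case Second
  from Second.prems show ?case by (auto elim!: eval_elims dest!: Second.IH(2))
next
  case Is_Node_Leaf
  from Is_Node_Leaf.prems show ?case by (auto elim!: eval_elims dest!: Is_Node_Leaf.IH(2))
next
  case Is_Node_Node
  from Is_Node_Node.prems show ?case by (auto elim!: eval_elims dest!: Is_Node_Node.IH(2))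
next
  case Cond_True
  from Cond_True.prems Cond_True.hyps show ?case
    by (auto elim!: eval_elims dest!: Cond_True.IH(2) Cond_True.IH(4))
next
  case Cond_False
  from Cond_False.prems show ?case
    by (auto elim!: eval_elims dest!: Cond_False.IH(2) Cond_False.IH(4))
next
  case Bind
  from Bind.prems show ?case by (auto elim!: eval_elims dest!: Bind.IH(2) Bind.IH(4))
next
  case Call
  from Call.prems show ?case by (auto elim!: eval_elims dest!: Call.IH(2) Call.IH(5))
next
  case Nil
  then show ?case by (auto elim: eval_elims)
next
  case Cons
  from Cons.prems show ?case by (auto elim!: eval_elims dest!: Cons.IH(2) Cons.IH(4))
qed

text \<open>Execution starts with the body of function \<open>0\<close>.\<close>

definition runs :: "program \<Rightarrow> val list \<Rightarrow> val \<Rightarrow> nat \<Rightarrow> bool" where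
  "runs P args v t \<longleftrightarrow> P \<noteq> [] \<and> eval P args (P ! 0) v t"


section \<open>Input and output of the enumeration problem\<close>

text \<open>
  A finitely supported array is given as a duplicate-free list, in any order, of its
  nonzero entries together with their indices.
\<close>

definition entries :: "('k \<times> nat) list \<Rightarrow> ('k \<Rightarrow> nat) \<Rightarrow> bool" where
  "entries xs f \<longleftrightarrow> distinct xs \<and> set xs = {(x, f x) | x. x \<in> supp f}"

primrec enc_list :: "val list \<Rightarrow> val" where
  "enc_list [] = Leaf 0"
| "enc_list (v # vs) = Node v (enc_list vs)"

definition enc_state :: "((nat \<times> nat) \<times> nat) list \<Rightarrow> val" where
  "enc_state xs = enc_list (map (\<lambda>((b, s), m). Node (Leaf b) (Node (Leaf s) (Leaf m))) xs)"

definition enc_family :: "((nat \<times> nat \<times> nat) \<times> nat) list \<Rightarrow> val" where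
  "enc_family xs =
     enc_list (map (\<lambda>((b, s, k), m). Node (Leaf b) (Node (Leaf s) (Node (Leaf k) (Leaf m)))) xs)"

text \<open>\<open>v\<close> encodes the weighted transition \<open>(u, \<nu>)\<close>.\<close>

definition represents_transition :: "state \<Rightarrow> nat \<Rightarrow> nat \<Rightarrow> nat \<times> family \<Rightarrow> val \<Rightarrow> bool" where
  "represents_transition H a r = (\<lambda>(u, \<nu>) v.
     \<exists>xs. entries xs \<nu> \<and>
          v = Node (Leaf u) (Node (enc_family xs) (Leaf (weight H a r u \<nu>))))"

text \<open>\<open>v\<close> is a list of all transitions with their weights, each transition occurring once.\<close>

definition lists_transitions :: "nat \<Rightarrow> state \<Rightarrow> nat \<Rightarrow> nat \<Rightarrow> val \<Rightarrow> bool" where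
  "lists_transitions d H a r v \<longleftrightarrow>
     (\<exists>ts vs. distinct ts \<and> set ts = transitions d H a r \<and>
        list_all2 (represents_transition H a r) ts vs \<and> v = enc_list vs)"

end

theory Submission
  imports Defs
begin

text \<open>
  The equation \<open>u + \<Sum> k \<alpha> \<nu> = r\<close> leaves room for at most \<open>r \<le> d\<close> units with \<open>k \<ge> 1\<close>, each sitting at one of
  \<open>O(n)\<close> positions \<open>(b, s, k)\<close>; the entries with \<open>k = 0\<close> and \<open>u\<close> are then forced.  Hence there are
  \<open>O(n ^ d)\<close> transitions.

  The transitions are generated by a depth-first search which goes through the rows \<open>(b, s)\<close> and, in each
  row, through the levels \<open>k = r, \<dots>, 0\<close>.  It either adds a unit at the current position or proceeds
  to the next position.  There are no dead ends, because the unspent budget can always go to \<open>u\<close> and the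
  undistributed part of a row to \<open>k = 0\<close>.  So the number of nodes of the search tree is at most its
  height times the number of transitions, and all values occurring in the computation have polynomial size.
\<close>

section \<open>The number of transitions\<close>

text \<open>The cost measure charges each step the full size of its value, and every call of the
  search returns the whole list found so far. A single step may therefore cost as much as the entire
  output, and the total estimate is quadratic in the number of transitions. It still gives
  polynomial overhead per transition because, for fixed \<open>d\<close>, one of the two factors is
  replaced by the bound \<open>(d + 1) ^ d * n ^ d\<close>: the counting half is an ingredient of
  the algorithmic half. The numbers need care as well. Dividing the factorial of a row by that of
  its undistributed part leaves a falling factorial with one factor per unit placed, hence at most
  \<open>r\<close> factors. This is why numerator and denominator can be bounded through the budget
  already spent. The program receives neither \<open>d\<close> nor \<open>n\<close>, and one program
  serves all \<open>d\<close>; only the polynomial depends on \<open>d\<close>.\<close>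

definition small_arrays :: "'a set \<Rightarrow> nat \<Rightarrow> ('a \<Rightarrow> nat) set" where
  "small_arrays X d = {f. supp f \<subseteq> X \<and> sum f X \<le> d}"

text \<open>Such an array arises from \<open>d\<close> successive choices, each either an increment
  at one of the \<open>card X\<close> positions or nothing, so there are \<open>card X + 1\<close>
  options per choice.\<close>

lemma finite_card_small_arrays:
  assumes "finite X"
  shows "finite (small_arrays X d) \<and> card (small_arrays X d) \<le> (card X + 1) ^ d"
proof (induction d)
  case 0
  have "small_arrays X 0 = {\<lambda>_. 0}"
    using assms by (auto simp: small_arrays_def supp_def fun_eq_iff subset_iff)
  then show ?case by simp
next
  case (Suc d)
  let ?A = "small_arrays X d"
  let ?inc = "\<lambda>(x, f). f(x := Suc (f x))"
  have sub: "small_arrays X (Suc d) \<subseteq> ?A \<union> ?inc ` (X \<times> ?A)"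
  proof
    fix f assume f: "f \<in> small_arrays X (Suc d)"
    show "f \<in> ?A \<union> ?inc ` (X \<times> ?A)"
    proof (cases "\<exists>x\<in>X. f x > 0")
      case True
      then obtain x where x: "x \<in> X" "f x > 0" by blast
      let ?g = "f(x := f x - 1)"
      have "sum f X = Suc (sum ?g X)"
        using x by (simp add: sum.remove[OF assms x(1)])
      with f x have "?g \<in> ?A"
        by (auto simp: small_arrays_def supp_def split: if_splits)
      moreover have "f = ?inc (x, ?g)" using x by simp
      ultimately show ?thesis using x by blast
    next
      case False
      then have "sum f X = 0" by simp
      with f show ?thesis by (simp add: small_arrays_def)
    qed
  qed
  have fin: "finite (?A \<union> ?inc ` (X \<times> ?A))"
    using Suc assms by blast
  have "card (?A \<union> ?inc ` (X \<times> ?A)) \<le> (card X + 1) * card ?A"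
  proof -
    have "card (?inc ` (X \<times> ?A)) \<le> card X * card ?A"
      using card_image_le[of "X \<times> ?A" ?inc] Suc assms by (simp add: card_cartesian_product)
    with card_Un_le[of ?A "?inc ` (X \<times> ?A)"] show ?thesis by simp
  qed
  then have "card (small_arrays X (Suc d)) \<le> (card X + 1) * card ?A"
    using card_mono[OF fin sub] by linarith
  moreover have "(card X + 1) * card ?A \<le> (card X + 1) ^ Suc d"
    using Suc by (simp only: power_Suc mult_le_mono2)
  ultimately show ?case using finite_subset[OF sub fin] by linarith
qed

lemma sum_over_superset_of_supp:
  fixes f :: "'a \<Rightarrow> nat"
  assumes "finite T" "S \<subseteq> T" "\<And>x. x \<in> T \<Longrightarrow> x \<notin> S \<Longrightarrow> f x = 0"
  shows "sum f S = sum f T"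
  using assms by (intro sum.mono_neutral_left) auto

lemma K_max_le: "K_max a r b s \<le> r"
  unfolding K_max_def by (meson div_le_dividend min.cobounded1 min.cobounded2 order_trans)

lemma alpha_pos: "b \<ge> 1 \<Longrightarrow> alpha a b \<ge> 1"
  unfolding alpha_def
  by (metis One_nat_def Suc_leI div_greater_zero_iff gcd_le2_nat gcd_pos_nat not_one_le_zero
      bot_nat_0.not_eq_extremum)

lemma beta_pos: "a \<ge> 1 \<Longrightarrow> beta a b \<ge> 1"
  using alpha_pos[of a b] by (simp add: beta_def alpha_def gcd.commute)

text \<open>The quotients in \<open>K_max\<close> turn into products, the form in which the search
  tests whether a unit may be added.\<close>

lemma le_K_max_iff:
  assumes "a \<ge> 1" "b \<ge> 1"
  shows "k \<le> K_max a r b s \<longleftrightarrow> k \<le> gcd a b \<and> k * alpha a b \<le> r \<and> k * beta a b \<le> s"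
  using alpha_pos[of b a] beta_pos[of a b] assms
  by (simp add: K_max_def less_eq_div_iff_mult_less_eq)

locale pivot =
  fixes d :: nat and H :: state and a r :: nat
  assumes normalized: "normalized d H" and pivot: "H (a, r) > 0"
begin

abbreviation h\<^sub>0 :: state where "h\<^sub>0 \<equiv> remaining H a r"

definition cost :: "(nat \<times> nat) set \<Rightarrow> family \<Rightarrow> nat" where
  "cost R \<nu> = (\<Sum>(b, s)\<in>R. \<Sum>k\<le>r. k * alpha a b * \<nu> (b, s, k))"

lemma supp_H: "(b, s) \<in> supp H \<Longrightarrow> 1 \<le> b \<and> 1 \<le> s \<and> s \<le> d"
  and finite_supp_H: "finite (supp H)"
  using normalized by (auto simp: normalized_def)

lemma a_pos: "1 \<le> a" and r_le: "r \<le> d"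
  using supp_H[of a r] pivot by (auto simp: supp_def)

lemma supp_remaining: "supp h\<^sub>0 \<subseteq> supp H"
  by (auto simp: supp_def remaining_def)

lemma sum_to_K_max:
  assumes "\<And>k. k > K_max a r b s \<Longrightarrow> f k = 0"
  shows "(\<Sum>k \<le> K_max a r b s. f k) = (\<Sum>k \<le> r. f k :: nat)"
  using assms K_max_le[of a r b s] by (intro sum_over_superset_of_supp) auto

section \<open>Transitions as admissible families with uniform ranges\<close>

definition admissible :: "family \<Rightarrow> bool" where
  "admissible \<nu> \<longleftrightarrow> (\<forall>b s k. \<nu> (b, s, k) \<noteq> 0 \<longrightarrow> (b, s) \<in> supp h\<^sub>0 \<and> k \<le> K_max a r b s)"

lemma admissible_zero:
  assumes "admissible \<nu>" "(b, s) \<notin> supp h\<^sub>0 \<or> k > K_max a r b s \<or> k > r"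
  shows "\<nu> (b, s, k) = 0"
  using assms K_max_le[of a r b s] unfolding admissible_def
  by (meson leD order.strict_trans1)

text \<open>Levels above \<open>K_max\<close> and rows outside the support carry nothing, so the
  ranges that vary with the row may be replaced by the fixed range \<open>k \<le> r\<close> and by
  any finite row set containing the support. Counting takes \<open>supp H\<close> for
  \<open>R\<close>; the search needs an additional artificial row.\<close>

lemma transitions_iff:
  assumes R: "finite R" "supp h\<^sub>0 \<subseteq> R"
  shows "(u, \<nu>) \<in> transitions d H a r \<longleftrightarrow>
    admissible \<nu> \<and> (\<forall>(b, s) \<in> R. (\<Sum>k\<le>r. \<nu> (b, s, k)) = h\<^sub>0 (b, s)) \<and> u + cost R \<nu> = r"
    (is "?L \<longleftrightarrow> ?R")
proof -
  have cost_eq: "(\<Sum>(b, s) \<in> supp h\<^sub>0. \<Sum>k \<le> K_max a r b s. k * alpha a b * \<nu> (b, s, k)) = cost R \<nu>"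
    if adm: "admissible \<nu>"
  proof -
    have "(\<Sum>(b, s) \<in> supp h\<^sub>0. \<Sum>k \<le> K_max a r b s. k * alpha a b * \<nu> (b, s, k))
        = (\<Sum>(b, s) \<in> supp h\<^sub>0. \<Sum>k \<le> r. k * alpha a b * \<nu> (b, s, k))"
      by (intro sum.cong) (auto intro!: sum_to_K_max simp: admissible_zero[OF adm])
    also have "\<dots> = cost R \<nu>"
      unfolding cost_def using R
      by (intro sum_over_superset_of_supp) (auto simp: admissible_zero[OF adm])
    finally show ?thesis .
  qed
  show ?thesis
  proof
    assume ?L
    then have u: "u \<le> r" and sup: "\<And>b s k. \<nu> (b, s, k) \<noteq> 0 \<Longrightarrow> 1 \<le> b \<and> 1 \<le> s \<and> s \<le> d \<and> k \<le> K_max a r b s"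
      and row: "\<And>b s. 1 \<le> b \<Longrightarrow> 1 \<le> s \<Longrightarrow> s \<le> d \<Longrightarrow> (\<Sum>k \<le> K_max a r b s. \<nu> (b, s, k)) = h\<^sub>0 (b, s)"
      and bud: "u + (\<Sum>(b, s) \<in> supp h\<^sub>0. \<Sum>k \<le> K_max a r b s. k * alpha a b * \<nu> (b, s, k)) = r"
      unfolding transitions_def families_def supp_def by simp_all
    have adm: "admissible \<nu>"
      unfolding admissible_def
    proof (intro allI impI)
      fix b s k assume nz: "\<nu> (b, s, k) \<noteq> 0"
      note * = sup[OF nz]
      \<comment> \<open>A nonzero entry makes its row sum nonzero, which puts the row into the
        support of the remaining state.\<close>
      have "\<nu> (b, s, k) \<le> (\<Sum>k \<le> K_max a r b s. \<nu> (b, s, k))"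
        using * by (intro member_le_sum) auto
      with nz row[of b s] * show "(b, s) \<in> supp h\<^sub>0 \<and> k \<le> K_max a r b s"
        by (auto simp: supp_def)
    qed
    moreover have "(\<Sum>k\<le>r. \<nu> (b, s, k)) = h\<^sub>0 (b, s)" if "(b, s) \<in> R" for b s
    proof (cases "(b, s) \<in> supp h\<^sub>0")
      case True
      then have "1 \<le> b \<and> 1 \<le> s \<and> s \<le> d" using supp_H supp_remaining by blast
      with row[of b s] show ?thesis
        using sum_to_K_max[of b s "\<lambda>k. \<nu> (b, s, k)"] admissible_zero[OF adm] by simp
    next
      case False
      then show ?thesis using admissible_zero[OF adm] by (simp add: supp_def)
    qed
    ultimately show ?R using bud cost_eq by auto
  next
    assume rhs: ?R
    then have adm: "admissible \<nu>" by blast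
    have "(\<Sum>k \<le> K_max a r b s. \<nu> (b, s, k)) = h\<^sub>0 (b, s)" for b s
    proof (cases "(b, s) \<in> R")
      case True
      with rhs have "(\<Sum>k\<le>r. \<nu> (b, s, k)) = h\<^sub>0 (b, s)" by blast
      then show ?thesis
        using sum_to_K_max[of b s "\<lambda>k. \<nu> (b, s, k)"] admissible_zero[OF adm] by simp
    next
      case False
      with R have "(b, s) \<notin> supp h\<^sub>0" by blast
      then show ?thesis using admissible_zero[OF adm] by (simp add: supp_def)
    qed
    moreover have "1 \<le> b \<and> 1 \<le> s \<and> s \<le> d \<and> k \<le> K_max a r b s" if "\<nu> (b, s, k) \<noteq> 0" for b s k
      using adm that supp_H supp_remaining unfolding admissible_def by blast
    ultimately show ?L
      using rhs cost_eq[OF adm]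
      unfolding transitions_def families_def supp_def by auto
  qed
qed

section \<open>Counting by the entries at positive levels\<close>

lemma card_transitions_le:
  "finite (transitions d H a r) \<and> card (transitions d H a r) \<le> (card (supp H) * d + 1) ^ d"
proof -
  define X where "X = {(b, s, k). (b, s) \<in> supp H \<and> k \<in> {1..d}}"
  have X: "X = (\<lambda>((b, s), k). (b, s, k)) ` (supp H \<times> {1..d})"
    by (force simp: X_def)
  have finX: "finite X" and cardX: "card X \<le> card (supp H) * d"
    using finite_supp_H card_image_le[of "supp H \<times> {1..d}" "\<lambda>((b, s), k). (b, s, k)"]
    by (simp_all add: X card_cartesian_product)
  \<comment> \<open>Only positive levels are kept; the mask makes the image an array supported in
    \<open>X\<close>, so that injectivity reduces the count to small arrays.\<close>
  define f where "f = (\<lambda>(u :: nat, \<nu> :: family) x. if x \<in> X then \<nu> x else 0)"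
  note iff = transitions_iff[OF finite_supp_H supp_remaining]
  have inj: "inj_on f (transitions d H a r)"
  proof (rule inj_onI, clarify)
    fix u \<nu> u' \<nu>'
    assume t: "(u, \<nu>) \<in> transitions d H a r" and t': "(u', \<nu>') \<in> transitions d H a r"
      and eq: "f (u, \<nu>) = f (u', \<nu>')"
    have eqX: "\<nu> x = \<nu>' x" if "x \<in> X" for x
      using fun_cong[OF eq, of x] that by (simp add: f_def)
    have adm: "admissible \<nu>" "admissible \<nu>'"
      using t t' iff by blast+
    have out: "\<nu> (b, s, k) = 0" "\<nu>' (b, s, k) = 0" if "(b, s) \<notin> supp H \<or> k > r" for b s k
      using adm that supp_remaining by (auto intro: admissible_zero)
    have pos: "\<nu> (b, s, k) = \<nu>' (b, s, k)" if "k \<ge> 1" for b s k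
      using eqX[of "(b, s, k)"] out[of b s k] that r_le
      by (cases "(b, s) \<in> supp H \<and> k \<le> r") (auto simp: X_def)
    have "\<nu> (b, s, 0) = \<nu>' (b, s, 0)" for b s
    proof (cases "(b, s) \<in> supp H")
      case True
      then have "(\<Sum>k\<le>r. \<nu> (b, s, k)) = (\<Sum>k\<le>r. \<nu>' (b, s, k))"
        using t t' True unfolding iff by fastforce
      then show ?thesis
        using pos by (simp add: sum.atMost_shift)
    qed (use out in auto)
    then have "\<nu> (b, s, k) = \<nu>' (b, s, k)" for b s k
      using pos by (cases k) auto
    then have "\<nu> = \<nu>'" by (auto simp: fun_eq_iff)
    with t t' show "u = u' \<and> \<nu> = \<nu>'" unfolding iff by simp
  qed
  have sub: "f ` transitions d H a r \<subseteq> small_arrays X d"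
  proof clarify
    fix u \<nu> assume t: "(u, \<nu>) \<in> transitions d H a r"
    have "sum (f (u, \<nu>)) X = (\<Sum>((b, s), k) \<in> supp H \<times> {1..d}. \<nu> (b, s, k))"
      unfolding X by (subst sum.reindex) (auto simp: inj_on_def f_def X intro!: sum.cong)
    also have "\<dots> = (\<Sum>(b, s) \<in> supp H. \<Sum>k \<in> {1..d}. \<nu> (b, s, k))"
      by (simp add: sum.cartesian_product case_prod_unfold)
    also have "\<dots> \<le> (\<Sum>(b, s) \<in> supp H. \<Sum>k \<le> r. k * alpha a b * \<nu> (b, s, k))"
    proof (intro sum_mono, clarify)
      fix b s assume bs: "(b, s) \<in> supp H"
      have "(\<Sum>k \<in> {1..d}. \<nu> (b, s, k)) = (\<Sum>k \<in> {1..r}. \<nu> (b, s, k))"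
        using t iff r_le
        by (intro sum.mono_neutral_right) (auto intro: admissible_zero)
      \<comment> \<open>Both \<open>k\<close> and \<open>alpha a b\<close> are at least 1, so the
        number of units is bounded by the budget they use.\<close>
      also have "\<dots> \<le> (\<Sum>k \<in> {1..r}. k * alpha a b * \<nu> (b, s, k))"
        using alpha_pos[of b a] supp_H[OF bs] by (intro sum_mono) auto
      also have "\<dots> \<le> (\<Sum>k \<le> r. k * alpha a b * \<nu> (b, s, k))"
        by (intro sum_mono2) auto
      finally show "(\<Sum>k \<in> {1..d}. \<nu> (b, s, k)) \<le> (\<Sum>k \<le> r. k * alpha a b * \<nu> (b, s, k))" .
    qed
    also have "\<dots> \<le> d"
      using t iff r_le unfolding cost_def by simp
    finally show "f (u, \<nu>) \<in> small_arrays X d"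
      by (auto simp: small_arrays_def supp_def f_def split: if_splits)
  qed
  note small = finite_card_small_arrays[OF finX, of d]
  have "finite (transitions d H a r)"
    using sub small inj finite_subset inj_on_finite by blast
  moreover have "card (transitions d H a r) \<le> (card X + 1) ^ d"
    using card_inj_on_le[OF inj sub] small by linarith
  moreover have "(card X + 1) ^ d \<le> (card (supp H) * d + 1) ^ d"
    using cardX by (intro power_mono) auto
  ultimately show ?thesis by (meson order_trans)
qed

text \<open>Each class contributes the product of the positive numbers \<open>b\<close> and
  \<open>H (b, s)\<close> to \<open>active_vertices H\<close>, so this sum dominates the number of
  classes, every index \<open>b\<close> and every multiplicity.\<close>

lemma active_vertices_bounds:
  assumes "active_vertices H \<le> n"
  shows "card (supp H) \<le> n" and "\<And>b s. (b, s) \<in> supp H \<Longrightarrow> b \<le> n \<and> H (b, s) \<le> n"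
proof -
  have "card (supp H) = (\<Sum>x \<in> supp H. 1)" by simp
  also have "\<dots> \<le> active_vertices H"
    unfolding active_vertices_def
  proof (intro sum_mono, clarify)
    fix b s assume bs: "(b, s) \<in> supp H"
    then have "H (b, s) \<ge> 1" by (simp add: supp_def)
    with supp_H[OF bs] show "1 \<le> b * H (b, s)" by (simp add: Suc_le_eq)
  qed
  finally show "card (supp H) \<le> n" using assms by simp
  fix b s assume bs: "(b, s) \<in> supp H"
  have "b * H (b, s) \<le> active_vertices H"
    unfolding active_vertices_def
    using member_le_sum[OF bs, of "\<lambda>(b, s). b * H (b, s)"] finite_supp_H by simp
  moreover have "b \<ge> 1" "H (b, s) \<ge> 1" using bs supp_H[OF bs] by (auto simp: supp_def)
  then have "b \<le> b * H (b, s)" "H (b, s) \<le> b * H (b, s)" by auto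
  ultimately show "b \<le> n \<and> H (b, s) \<le> n" using assms by linarith
qed

lemma card_transitions_le_power:
  assumes "active_vertices H \<le> n"
  shows "card (transitions d H a r) \<le> (d + 1) ^ d * n ^ d"
proof -
  have "n \<ge> 1"
    using active_vertices_bounds(2)[OF assms, of a r] pivot by (auto simp: supp_def)
  moreover have "card (supp H) * d \<le> n * d"
    using active_vertices_bounds(1)[OF assms] by simp
  \<comment> \<open>The summand 1 is absorbed by \<open>n \<ge> 1\<close>, which leaves a pure power
    of \<open>n\<close> in the final bound.\<close>
  ultimately have "card (supp H) * d + 1 \<le> (d + 1) * n" 
    using add_mono[of "card (supp H) * d" "n * d" 1 n] by (simp add: algebra_simps)
  then have "(card (supp H) * d + 1) ^ d \<le> ((d + 1) * n) ^ d"
    by (intro power_mono) auto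
  with card_transitions_le show ?thesis
    by (metis order_trans power_mult_distrib)
qed

end

section \<open>Depth-first search\<close>

lemma coeff_one_plus_square_power:
  "coeff ([:1, 0, 1:] ^ m :: nat poly) u = (if even u then m choose (u div 2) else 0)"
proof (induction m arbitrary: u)
  case 0
  then show ?case by (cases u) (auto elim: evenE)
next
  case (Suc m)
  have "([:1, 0, 1:] ^ Suc m :: nat poly) = [:1, 0, 1:] ^ m + pCons 0 (pCons 0 ([:1, 0, 1:] ^ m))"
    by (simp del: One_nat_def)
  with Suc show ?case
    by (cases u rule: nat.exhaust; cases "u - 1") (auto simp del: power_Suc)
qed

text \<open>For even \<open>a\<close> the factor \<open>1 + x\<close> copies each coefficient of an
  even power to the next odd power; for odd \<open>a\<close> the odd powers are absent. The first
  factor is 0 exactly when \<open>a\<close> and \<open>u\<close> are both odd, so the program needs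
  no case distinction.\<close>

lemma I_coeff_eq:
  assumes "a \<ge> 1"
  shows "I_coeff a u = (1 - (a mod 2) * (u mod 2)) * ((a - 1) div 2 choose (u div 2))"
proof (cases "even a")
  case True
  have "P_poly a = [:1, 0, 1:] ^ ((a - 1) div 2) + pCons 0 ([:1, 0, 1:] ^ ((a - 1) div 2))"
    using True by (simp add: P_poly_def del: One_nat_def)
  with True show ?thesis
    by (cases u) (auto simp: I_coeff_def coeff_one_plus_square_power elim: oddE simp del: One_nat_def)
next
  case False
  then show ?thesis
    by (cases "even u") (auto simp: I_coeff_def P_poly_def coeff_one_plus_square_power
        odd_iff_mod_2_eq_one simp del: One_nat_def)
qed

type_synonym entry_list = "((nat \<times> nat \<times> nat) \<times> nat) list"

text \<open>Zeros are dropped because the output format lists nonzero entries only.\<close>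

definition push :: "'k \<Rightarrow> nat \<Rightarrow> ('k \<times> nat) list \<Rightarrow> ('k \<times> nat) list" where
  "push x m xs = (if m = 0 then xs else (x, m) # xs)"

text \<open>The hypothesis on \<open>f(x := 0)\<close> ensures that \<open>x\<close> is not listed
  yet, so the new entry creates no duplicate.\<close>

lemma entries_push:
  assumes "entries xs (f(x := 0))"
  shows "entries (push x m xs) (f(x := m))"
  using assms by (auto simp: entries_def push_def supp_def split: if_splits)

text \<open>
  At level \<open>k\<close> of row \<open>(b, s)\<close>, the search has used \<open>j\<close> units at this level, \<open>h\<close> copies of the row are not
  yet distributed, and \<open>u\<close> is the unspent budget.  The weight is kept as a fraction \<open>w / q\<close>, since it is
  an integer only at the end.
\<close>

context
  fixes a r :: nat
begin

fun search :: "nat \<Rightarrow> nat \<Rightarrow> nat \<Rightarrow> nat \<Rightarrow> nat \<Rightarrow> nat \<Rightarrow> entry_list \<Rightarrow> nat \<Rightarrow> nat \<Rightarrow>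
    ((nat \<times> nat) \<times> nat) list \<Rightarrow> (nat \<times> entry_list \<times> nat) list"
where
  "search b s 0 j h u fam w q [] = [(u, push (b, s, 0) h fam, I_coeff a u * w div q)]"
| "search b s 0 j h u fam w q (((b', s'), m) # rest) =
    search b' s' r 0 (m - of_bool (b' = a \<and> s' = r)) u (push (b, s, 0) h fam) w q rest"
| "search b s (Suc k) j h u fam w q rest =
    (if h > 0 \<and> Suc k * alpha a b \<le> u \<and> Suc k \<le> gcd a b \<and> Suc k * beta a b \<le> s
     then search b s (Suc k) (Suc j) (h - 1) (u - Suc k * alpha a b) fam
       (w * h * (gcd a b choose Suc k)) (q * Suc j) rest
     else []) @
    search b s k 0 h u (push (b, s, Suc k) j fam) w q rest"

end

text \<open>A unit changes one entry of one row. Its effect on a double product follows by two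
  applications, one for the row and one for the level.\<close>

lemma prod_change_factor:
  fixes f g :: "'a \<Rightarrow> nat"
  assumes "finite S" "x \<in> S" "g x = c * f x" "\<And>y. y \<in> S \<Longrightarrow> y \<noteq> x \<Longrightarrow> g y = f y"
  shows "prod g S = c * prod f S"
proof -
  have "prod g (S - {x}) = prod f (S - {x})"
    using assms(4) by (intro prod.cong) auto
  then show ?thesis
    using assms(1-3) by (simp add: prod.remove)
qed

lemma sum_change_summand:
  fixes f g :: "'a \<Rightarrow> nat"
  assumes "finite S" "x \<in> S" "g x = f x + c" "\<And>y. y \<in> S \<Longrightarrow> y \<noteq> x \<Longrightarrow> g y = f y"
  shows "sum g S = sum f S + c"
proof -
  have "sum g (S - {x}) = sum f (S - {x})"
    using assms(4) by (intro sum.cong) auto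
  then show ?thesis
    using assms(1-3) by (simp add: sum.remove)
qed

context pivot
begin

text \<open>The search starts from the artificial row \<open>(0, 0)\<close>, which holds nothing to distribute.\<close>

definition rows :: "(nat \<times> nat) set" where
  "rows = insert (0, 0) (supp H)"

lemma rows: "finite rows" "supp h\<^sub>0 \<subseteq> rows"
  using finite_supp_H supp_remaining by (auto simp: rows_def)

lemmas transitions_rows_iff = transitions_iff[OF rows]

section \<open>The weight of a partial family as a fraction\<close>

definition moved :: "family \<Rightarrow> nat \<times> nat \<Rightarrow> nat" where
  "moved \<psi> = (\<lambda>(b, s). \<Sum>k\<in>{1..r}. \<psi> (b, s, k))"

definition unmoved_facts :: "family \<Rightarrow> nat" where
  "unmoved_facts \<psi> = (\<Prod>x\<in>rows. fact (h\<^sub>0 x - moved \<psi> x))"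

definition binomials :: "family \<Rightarrow> nat" where
  "binomials \<psi> = (\<Prod>(b, s)\<in>rows. \<Prod>k\<in>{1..r}. (gcd a b choose k) ^ \<psi> (b, s, k))"

definition moved_facts :: "family \<Rightarrow> nat" where
  "moved_facts \<psi> = (\<Prod>(b, s)\<in>rows. \<Prod>k\<in>{1..r}. fact (\<psi> (b, s, k)))"

text \<open>A division-free way to say that \<open>w\<close> is the product of all falling
  factorials \<open>fact (h\<^sub>0 x) / fact (h\<^sub>0 x - moved \<psi> x)\<close> and of the
  binomials. Copies not moved to a positive level count as if they stayed at level 0; as their
  binomial factor is 1, the entries at level 0 do not enter at all.\<close>

definition fraction :: "family \<Rightarrow> nat \<Rightarrow> nat \<Rightarrow> bool" where
  "fraction \<psi> w q \<longleftrightarrow>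
    w * unmoved_facts \<psi> = (\<Prod>x\<in>rows. fact (h\<^sub>0 x)) * binomials \<psi> \<and> q = moved_facts \<psi>"

lemma sum_atMost_eq_moved: "(\<Sum>k\<le>r. \<psi> (b, s, k)) = \<psi> (b, s, 0) + moved \<psi> (b, s)"
  by (simp add: moved_def atMost_atLeast0 sum.atLeast_Suc_atMost)

lemma moved_update_zero: "moved (\<psi>((b, s, 0) := m)) = moved \<psi>"
  by (auto simp: moved_def fun_eq_iff intro!: sum.cong)

lemma fraction_update_zero: "fraction (\<psi>((b, s, 0) := m)) w q = fraction \<psi> w q"
  by (auto simp: fraction_def unmoved_facts_def moved_update_zero binomials_def moved_facts_def
      intro!: arg_cong2[where f = "(*)"] arg_cong2[where f = "(=)"] prod.cong)

lemma moved_Suc: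
  assumes "k \<in> {1..r}"
  shows "moved (\<psi>((b, s, k) := Suc (\<psi> (b, s, k)))) (b, s) = Suc (moved \<psi> (b, s))"
  unfolding moved_def
  using sum_change_summand[of "{1..r}" k "\<lambda>i. (\<psi>((b, s, k) := Suc (\<psi> (b, s, k)))) (b, s, i)"
      "\<lambda>i. \<psi> (b, s, i)" 1] assms by simp

lemma moved_update_other: "x \<noteq> (b, s) \<Longrightarrow> moved (\<psi>((b, s, k) := m)) x = moved \<psi> x"
  by (auto simp: moved_def split: prod.split if_split_asm intro!: sum.cong)

lemma cost_Suc:
  assumes "(b, s) \<in> rows" "k \<le> r"
  shows "cost rows (\<psi>((b, s, k) := \<psi> (b, s, k) + m)) = cost rows \<psi> + k * alpha a b * m"
  unfolding cost_def
proof (rule sum_change_summand[where x = "(b, s)"])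
  show "(case (b, s) of (b', s') \<Rightarrow>
      \<Sum>i\<le>r. i * alpha a b' * (\<psi>((b, s, k) := \<psi> (b, s, k) + m)) (b', s', i)) =
    (case (b, s) of (b', s') \<Rightarrow> \<Sum>i\<le>r. i * alpha a b' * \<psi> (b', s', i)) + k * alpha a b * m"
    unfolding prod.case using assms
    by (intro sum_change_summand[where x = k]) (auto simp: algebra_simps)
qed (use assms rows in \<open>auto split: if_split_asm intro!: sum.cong\<close>)

lemma binomials_Suc:
  assumes "(b, s) \<in> rows" "k \<in> {1..r}"
  shows "binomials (\<psi>((b, s, k) := Suc (\<psi> (b, s, k)))) = (gcd a b choose k) * binomials \<psi>"
  unfolding binomials_def
proof (rule prod_change_factor[where x = "(b, s)"])
  show "(case (b, s) of (b', s') \<Rightarrow>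
      \<Prod>i\<in>{1..r}. (gcd a b' choose i) ^ (\<psi>((b, s, k) := Suc (\<psi> (b, s, k)))) (b', s', i)) =
    (gcd a b choose k) * (case (b, s) of (b', s') \<Rightarrow> \<Prod>i\<in>{1..r}. (gcd a b' choose i) ^ \<psi> (b', s', i))"
    unfolding prod.case using assms
    by (intro prod_change_factor[where x = k]) auto
qed (use assms rows in \<open>auto split: if_split_asm intro!: prod.cong\<close>)

lemma moved_facts_Suc:
  assumes "(b, s) \<in> rows" "k \<in> {1..r}"
  shows "moved_facts (\<psi>((b, s, k) := Suc (\<psi> (b, s, k)))) = Suc (\<psi> (b, s, k)) * moved_facts \<psi>"
  unfolding moved_facts_def
proof (rule prod_change_factor[where x = "(b, s)"])
  show "(case (b, s) of (b', s') \<Rightarrow>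
      \<Prod>i\<in>{1..r}. fact ((\<psi>((b, s, k) := Suc (\<psi> (b, s, k)))) (b', s', i))) =
    Suc (\<psi> (b, s, k)) * (case (b, s) of (b', s') \<Rightarrow> \<Prod>i\<in>{1..r}. fact (\<psi> (b', s', i)))"
    unfolding prod.case using assms
    by (intro prod_change_factor[where x = k]) auto
qed (use assms rows in \<open>auto split: if_split_asm intro!: prod.cong\<close>)

lemma unmoved_facts_Suc:
  assumes "(b, s) \<in> rows" "k \<in> {1..r}" "moved \<psi> (b, s) < h\<^sub>0 (b, s)"
  shows "unmoved_facts \<psi> =
    (h\<^sub>0 (b, s) - moved \<psi> (b, s)) * unmoved_facts (\<psi>((b, s, k) := Suc (\<psi> (b, s, k))))"
  unfolding unmoved_facts_def
proof (rule prod_change_factor[where x = "(b, s)"])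
  obtain m where m: "h\<^sub>0 (b, s) = Suc (moved \<psi> (b, s) + m)"
    using assms(3) less_imp_Suc_add by blast
  show "fact (h\<^sub>0 (b, s) - moved \<psi> (b, s)) = (h\<^sub>0 (b, s) - moved \<psi> (b, s)) *
    fact (h\<^sub>0 (b, s) - moved (\<psi>((b, s, k) := Suc (\<psi> (b, s, k)))) (b, s))"
    by (simp add: moved_Suc[OF assms(2)] m del: fun_upd_apply)
qed (use assms rows in \<open>auto simp: moved_update_other\<close>)

text \<open>Moving a copy takes the factor \<open>h\<close> out of the factorial of the unmoved
  copies, hence \<open>w\<close> gains it together with one more binomial; \<open>q\<close> gains
  the factor by which \<open>fact (\<psi> (b, s, k))\<close> grows. With nothing at level 0,
  \<open>h\<close> is exactly the number of unmoved copies.\<close>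

lemma fraction_Suc:
  assumes "fraction \<psi> w q" "(b, s) \<in> rows" "k \<in> {1..r}" "\<psi> (b, s, 0) = 0"
    and "(\<Sum>k\<le>r. \<psi> (b, s, k)) + h = h\<^sub>0 (b, s)" "h > 0"
  shows "fraction (\<psi>((b, s, k) := Suc (\<psi> (b, s, k)))) (w * h * (gcd a b choose k))
    (q * Suc (\<psi> (b, s, k)))"
proof -
  have "moved \<psi> (b, s) < h\<^sub>0 (b, s)" "h\<^sub>0 (b, s) - moved \<psi> (b, s) = h"
    using assms(4-6) by (simp_all add: sum_atMost_eq_moved)
  then have "unmoved_facts \<psi> = h * unmoved_facts (\<psi>((b, s, k) := Suc (\<psi> (b, s, k))))"
    using unmoved_facts_Suc[OF assms(2,3), of \<psi>] by simp
  with assms(1) show ?thesis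
    unfolding fraction_def
    by (simp add: binomials_Suc[OF assms(2,3)] moved_facts_Suc[OF assms(2,3)] algebra_simps
        del: fun_upd_apply)
qed

lemma weight_eq:
  assumes "(u, \<nu>) \<in> transitions d H a r" and "fraction \<nu> w q"
  shows "weight H a r u \<nu> = I_coeff a u * w div q"
proof -
  have adm: "admissible \<nu>" and row: "\<And>b s. (b, s) \<in> rows \<Longrightarrow> (\<Sum>k\<le>r. \<nu> (b, s, k)) = h\<^sub>0 (b, s)"
    using assms(1) by (auto simp: transitions_rows_iff)
  define W where "W = (\<lambda>(b, s). W_factor H a r \<nu> b s)"
  have to_K: "(\<Prod>k \<le> K_max a r b s. f k) = (\<Prod>k\<le>r. f k :: nat)"
    if "\<And>k. \<nu> (b, s, k) = 0 \<Longrightarrow> f k = 1" for b s f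
    using that K_max_le[of a r b s] admissible_zero[OF adm, of b s]
    by (intro prod.mono_neutral_left) auto
  have split0: "(\<Prod>k\<le>r. f k) = f 0 * (\<Prod>k\<in>{1..r}. f k :: nat)" for f
    by (simp add: atMost_atLeast0 prod.atLeast_Suc_atMost)
  \<comment> \<open>The quotient in \<open>W_factor\<close> is exact, so it can be traded for a
    product; level 0 contributes only its factorial.\<close>
  have W: "W (b, s) * (fact (\<nu> (b, s, 0)) * (\<Prod>k\<in>{1..r}. fact (\<nu> (b, s, k)))) =
      fact (h\<^sub>0 (b, s)) * (\<Prod>k\<in>{1..r}. (gcd a b choose k) ^ \<nu> (b, s, k))"
    if "(b, s) \<in> rows" for b s
  proof -
    have "(\<Prod>k\<le>r. fact (\<nu> (b, s, k)) :: nat) dvd fact (h\<^sub>0 (b, s))"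
      using prod_fact_dvd_fact_sum[of "\<lambda>k. \<nu> (b, s, k)" r] row[OF that] by simp
    then have "W (b, s) * (\<Prod>k\<le>r. fact (\<nu> (b, s, k))) =
      fact (h\<^sub>0 (b, s)) * (\<Prod>k\<le>r. (gcd a b choose k) ^ \<nu> (b, s, k))"
      by (simp add: W_def W_factor_def to_K mult.commute mult.left_commute)
    then show ?thesis by (simp add: split0)
  qed
  have W_out: "W x = 1" if "x \<notin> supp h\<^sub>0" for x
  proof -
    obtain b s where x: "x = (b, s)" by fastforce
    then have "h\<^sub>0 (b, s) = 0" "\<And>k. \<nu> (b, s, k) = 0"
      using that admissible_zero[OF adm] by (auto simp: supp_def)
    then show ?thesis by (simp add: W_def W_factor_def x)
  qed
  \<comment> \<open>In a complete family the unmoved copies are precisely those at level 0.\<close>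
  have "unmoved_facts \<nu> = (\<Prod>(b, s)\<in>rows. fact (\<nu> (b, s, 0)))"
    unfolding unmoved_facts_def
  proof (rule prod.cong)
    fix x assume x: "x \<in> rows"
    obtain b s where "x = (b, s)" by fastforce
    with row[of b s] x show "fact (h\<^sub>0 x - moved \<nu> x) = (case x of (b, s) \<Rightarrow> fact (\<nu> (b, s, 0)))"
      by (simp add: sum_atMost_eq_moved flip: row)
  qed simp
  moreover have "prod W rows * ((\<Prod>(b, s)\<in>rows. fact (\<nu> (b, s, 0))) * moved_facts \<nu>) =
    (\<Prod>x\<in>rows. fact (h\<^sub>0 x)) * binomials \<nu>"
    unfolding moved_facts_def binomials_def
    using W by (auto simp flip: prod.distrib intro!: prod.cong)
  \<comment> \<open>Cancelling \<open>unmoved_facts \<nu>\<close> gives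
    \<open>w = prod W rows * q\<close>, so the division at the end of the search is exact.\<close>
  ultimately have "unmoved_facts \<nu> * (prod W rows * q) = unmoved_facts \<nu> * w"
    using assms(2) by (simp add: fraction_def mult_ac)
  moreover have "unmoved_facts \<nu> > 0" "q > 0"
    using assms(2) by (auto simp: unmoved_facts_def fraction_def moved_facts_def intro!: prod_pos)
  moreover have "prod W rows = (\<Prod>(b, s) \<in> supp h\<^sub>0. W_factor H a r \<nu> b s)"
    using rows W_out unfolding W_def by (intro prod.mono_neutral_right) auto
  ultimately have "I_coeff a u * w = weight H a r u \<nu> * q" "q > 0"
    by (auto simp: weight_def)
  then show ?thesis by simp
qed


text \<open>
  \<open>\<psi>\<close> is the partial family of the search, including the \<open>j\<close> units of the current level,
  which are not yet recorded in \<open>fam\<close>.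
\<close>

definition reached :: "nat \<Rightarrow> nat \<Rightarrow> nat \<Rightarrow> nat \<Rightarrow> nat \<Rightarrow> nat \<Rightarrow> entry_list \<Rightarrow> nat \<Rightarrow> nat \<Rightarrow>
    ((nat \<times> nat) \<times> nat) list \<Rightarrow> family \<Rightarrow> bool" where
  "reached b s k j h u fam w q rest \<psi> \<longleftrightarrow>
    (b, s) \<in> rows \<and> (b, s) \<notin> fst ` set rest \<and> distinct (map fst rest) \<and>
    (\<forall>(x, m) \<in> set rest. x \<in> rows \<and> m = H x) \<and>
    k \<le> r \<and> (k = 0 \<longrightarrow> j = 0) \<and>
    admissible \<psi> \<and> \<psi> (b, s, k) = j \<and> entries fam (\<psi>((b, s, k) := 0)) \<and>
    (\<forall>i < k. \<psi> (b, s, i) = 0) \<and> (\<forall>(b', s') \<in> fst ` set rest. \<forall>i. \<psi> (b', s', i) = 0) \<and>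
    (\<Sum>i\<le>r. \<psi> (b, s, i)) + h = h\<^sub>0 (b, s) \<and>
    (\<forall>(b', s') \<in> rows - insert (b, s) (fst ` set rest). (\<Sum>i\<le>r. \<psi> (b', s', i)) = h\<^sub>0 (b', s')) \<and>
    u + cost rows \<psi> = r \<and> fraction \<psi> w q"

text \<open>The transitions that the subtree below a search node has to produce. At the current
  level the entry is only bounded below, since further units may still be added there; lower levels
  and the rows in \<open>rest\<close> are open.\<close>

definition completions :: "nat \<Rightarrow> nat \<Rightarrow> nat \<Rightarrow> ((nat \<times> nat) \<times> nat) list \<Rightarrow> family \<Rightarrow> (nat \<times> family) set" where
  "completions b s k rest \<psi> = {(u, \<nu>) \<in> transitions d H a r.
    (\<forall>b' s' i. (b', s') \<notin> fst ` set rest \<and> ((b', s') = (b, s) \<longrightarrow> i > k) \<longrightarrow>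
      \<nu> (b', s', i) = \<psi> (b', s', i)) \<and> \<psi> (b, s, k) \<le> \<nu> (b, s, k)}"

lemma sum_row_Suc:
  fixes \<psi> :: family
  assumes "k \<le> r"
  shows "(\<Sum>i\<le>r. (\<psi>((b, s, k) := \<psi> (b, s, k) + m)) (b, s, i)) = (\<Sum>i\<le>r. \<psi> (b, s, i)) + m"
  using assms by (intro sum_change_summand[where x = k]) auto

lemma sum_row_other:
  "(b', s') \<noteq> (b, s) \<Longrightarrow> (\<Sum>i\<le>r. (\<psi>((b, s, k) := m)) (b', s', i)) = (\<Sum>i\<le>r. \<psi> (b', s', i))"
  by (intro sum.cong) auto

lemma rest_zero_update:
  "(b, s) \<notin> X \<Longrightarrow> \<forall>(b', s') \<in> X. \<forall>i. \<psi> (b', s', i) = (0 :: nat) \<Longrightarrow>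
    \<forall>(b', s') \<in> X. \<forall>i. (\<psi>((b, s, k) := m)) (b', s', i) = 0"
  by auto

section \<open>The moves of the search: closing a row, closing a level, adding a unit\<close>

lemma completions_zero:
  assumes "reached b s 0 j h u fam w q rest \<psi>" "(u', \<nu>) \<in> completions b s 0 rest \<psi>"
  shows "\<nu> (b, s, 0) = h"
proof -
  have bs: "(b, s) \<in> rows" "(b, s) \<notin> fst ` set rest" "\<psi> (b, s, 0) = 0"
    "(\<Sum>i\<le>r. \<psi> (b, s, i)) + h = h\<^sub>0 (b, s)"
    using assms(1) unfolding reached_def by auto
  have "\<nu> (b, s, i) = \<psi> (b, s, i)" if "i > 0" for i
    using assms(2) bs that unfolding completions_def by blast
  then have "moved \<nu> (b, s) = moved \<psi> (b, s)"
    by (auto simp: moved_def intro!: sum.cong)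
  moreover have "(\<Sum>i\<le>r. \<nu> (b, s, i)) = h\<^sub>0 (b, s)"
    using assms(2) bs by (auto simp: completions_def transitions_rows_iff)
  ultimately show ?thesis using bs by (simp add: sum_atMost_eq_moved)
qed

lemma reached_zero:
  assumes "reached b s 0 j h u fam w q rest \<psi>"
  defines "\<psi>' \<equiv> \<psi>((b, s, 0) := h)"
  shows "admissible \<psi>'" "entries (push (b, s, 0) h fam) \<psi>'" "cost rows \<psi>' = cost rows \<psi>"
    "(\<Sum>i\<le>r. \<psi>' (b, s, i)) = h\<^sub>0 (b, s)" "fraction \<psi>' w q"
    "\<psi>' = \<psi>((b, s, 0) := \<psi> (b, s, 0) + h)"
proof -
  note r = assms(1)[unfolded reached_def]
  show eq: "\<psi>' = \<psi>((b, s, 0) := \<psi> (b, s, 0) + h)"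
    using r by (auto simp: \<psi>'_def)
  show "admissible \<psi>'"
    using r by (auto simp: admissible_def \<psi>'_def supp_def)
  show "entries (push (b, s, 0) h fam) \<psi>'"
    using r unfolding \<psi>'_def by (blast intro: entries_push)
  show "cost rows \<psi>' = cost rows \<psi>"
    using r cost_Suc[of b s 0 \<psi> h] unfolding eq by simp
  show "(\<Sum>i\<le>r. \<psi>' (b, s, i)) = h\<^sub>0 (b, s)"
    using r sum_row_Suc[of 0 \<psi> b s h] unfolding eq by simp
  show "fraction \<psi>' w q"
    using r unfolding \<psi>'_def fraction_update_zero by blast
qed

lemma completions_end:
  assumes "reached b s 0 j h u fam w q [] \<psi>"
  shows "completions b s 0 [] \<psi> = {(u, \<psi>((b, s, 0) := h))}"
proof -
  let ?\<psi>' = "\<psi>((b, s, 0) := h)"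
  note r = assms[unfolded reached_def] and r0 = reached_zero[OF assms]
  have "(\<Sum>i\<le>r. ?\<psi>' (b', s', i)) = h\<^sub>0 (b', s')" if "(b', s') \<in> rows" for b' s'
    using r r0(4) sum_row_other[of b' s' b s \<psi> 0 h] that by (cases "(b', s') = (b, s)") auto
  then have t: "(u, ?\<psi>') \<in> transitions d H a r"
    using r r0(1,3) by (auto simp: transitions_rows_iff)
  then have "(u, ?\<psi>') \<in> completions b s 0 [] \<psi>"
    using r by (auto simp: completions_def)
  moreover have "x = (u, ?\<psi>')" if "x \<in> completions b s 0 [] \<psi>" for x
  proof -
    obtain u' \<nu> where x: "x = (u', \<nu>)" by fastforce
    with that have c: "(u', \<nu>) \<in> completions b s 0 [] \<psi>" by simp
    have "\<nu> (b', s', i) = ?\<psi>' (b', s', i)" for b' s' i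
      using completions_zero[OF assms c] c
      by (cases "(b', s', i) = (b, s, 0)") (auto simp: completions_def)
    then have "\<nu> = ?\<psi>'" by (auto simp: fun_eq_iff)
    moreover have "(u', \<nu>) \<in> transitions d H a r"
      using c by (auto simp: completions_def)
    \<comment> \<open>The families agree, hence so do their costs, and the two budget equations
      force \<open>u' = u\<close>.\<close>
    ultimately show ?thesis
      using t unfolding x transitions_rows_iff by (metis add_right_cancel)
  qed
  ultimately show ?thesis by blast
qed

lemma reached_next_row:
  assumes "reached b s 0 j h u fam w q (((b', s'), m) # rest) \<psi>"
  shows "reached b' s' r 0 (m - of_bool (b' = a \<and> s' = r)) u (push (b, s, 0) h fam) w q rest
    (\<psi>((b, s, 0) := h))"
proof -
  let ?\<psi>' = "\<psi>((b, s, 0) := h)"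
  note r = assms[unfolded reached_def] and r0 = reached_zero[OF assms]
  have ne: "(b', s') \<noteq> (b, s)" using r by auto
  have z: "?\<psi>' (b', s', i) = 0" for i using r ne by auto
  then have "?\<psi>'((b', s', r) := 0) = ?\<psi>'" by (rule fun_upd_idem)
  \<comment> \<open>The input lists \<open>H\<close>, not the remaining state; the
    \<open>of_bool\<close> term removes the pivot copy.\<close>
  moreover have "(\<Sum>i\<le>r. ?\<psi>' (b', s', i)) + (m - of_bool (b' = a \<and> s' = r)) = h\<^sub>0 (b', s')"
    unfolding z using r by (auto simp: remaining_def)
  moreover have "(\<Sum>i\<le>r. ?\<psi>' (b'', s'', i)) = h\<^sub>0 (b'', s'')"
    if "(b'', s'') \<in> rows - insert (b', s') (fst ` set rest)" for b'' s''
    using r r0(4) sum_row_other[of b'' s'' b s \<psi> 0 h] that by (cases "(b'', s'') = (b, s)") auto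
  moreover have "\<forall>(b'', s'') \<in> fst ` set rest. \<forall>i. ?\<psi>' (b'', s'', i) = 0"
    using r by (intro rest_zero_update) auto
  ultimately show ?thesis
    unfolding reached_def using r r0(1-5) z by (auto simp del: fun_upd_apply)
qed

text \<open>Entering the next row at level \<open>r\<close> loses nothing: above \<open>r\<close>
  all admissible families vanish, and at level \<open>r\<close> the lower bound is 0.\<close>

lemma completions_next_row:
  assumes "reached b s 0 j h u fam w q (((b', s'), m) # rest) \<psi>"
  shows "completions b s 0 (((b', s'), m) # rest) \<psi> =
    completions b' s' r rest (\<psi>((b, s, 0) := h))"
proof -
  let ?\<psi>' = "\<psi>((b, s, 0) := h)"
  note r = assms[unfolded reached_def]
  have ne: "(b', s') \<noteq> (b, s)" and pz: "\<psi> (b, s, 0) = 0"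
    using r by auto
  have z: "\<psi> (b', s', i) = 0" for i using r by auto
  have "(u', \<nu>) \<in> completions b' s' r rest ?\<psi>'"
    if c: "(u', \<nu>) \<in> completions b s 0 (((b', s'), m) # rest) \<psi>" for u' \<nu>
  proof -
    have t: "(u', \<nu>) \<in> transitions d H a r" and
      eq: "\<And>b'' s'' i. (b'', s'') \<notin> fst ` set rest \<Longrightarrow> (b'', s'') \<noteq> (b', s') \<Longrightarrow>
        ((b'', s'') = (b, s) \<Longrightarrow> i > 0) \<Longrightarrow> \<nu> (b'', s'', i) = \<psi> (b'', s'', i)"
      using c unfolding completions_def by auto
    have "admissible \<nu>" using t by (auto simp: transitions_rows_iff)
    then have "\<nu> (b', s', i) = 0" if "i > r" for i
      using that by (auto intro: admissible_zero)
    then have "\<nu> (b'', s'', i) = ?\<psi>' (b'', s'', i)"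
      if "(b'', s'') \<notin> fst ` set rest" "(b'', s'') = (b', s') \<Longrightarrow> i > r" for b'' s'' i
      using that completions_zero[OF assms c] eq[of b'' s'' i] z ne
      by (cases "(b'', s'') = (b', s')"; cases "(b'', s'', i) = (b, s, 0)") auto
    moreover have "?\<psi>' (b', s', r) = 0" using z ne by auto
    ultimately show ?thesis using t by (auto simp: completions_def simp del: fun_upd_apply)
  qed
  moreover have "(u', \<nu>) \<in> completions b s 0 (((b', s'), m) # rest) \<psi>"
    if c: "(u', \<nu>) \<in> completions b' s' r rest ?\<psi>'" for u' \<nu>
  proof -
    have "\<nu> (b'', s'', i) = \<psi> (b'', s'', i)"
      if "(b'', s'') \<notin> insert (b', s') (fst ` set rest)" "(b'', s'') = (b, s) \<Longrightarrow> i > 0" for b'' s'' i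
      using c that by (cases "(b'', s'', i) = (b, s, 0)") (auto simp: completions_def)
    then show ?thesis using c pz by (auto simp: completions_def)
  qed
  ultimately show ?thesis by auto
qed

text \<open>The partial family already contains the \<open>j\<close> units of the level being
  closed, so it stays the same and only the list \<open>fam\<close> catches up.\<close>

lemma reached_next_level:
  assumes "reached b s (Suc k) j h u fam w q rest \<psi>"
  shows "reached b s k 0 h u (push (b, s, Suc k) j fam) w q rest \<psi>"
proof -
  note r = assms[unfolded reached_def]
  have "entries (push (b, s, Suc k) j fam) (\<psi>((b, s, Suc k) := j))"
    using r by (blast intro: entries_push)
  moreover have "\<psi>((b, s, Suc k) := j) = \<psi>" "\<psi>((b, s, k) := 0) = \<psi>" "\<psi> (b, s, k) = 0"
    using r by auto
  ultimately show ?thesis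
    using r unfolding reached_def by simp
qed

lemma reached_unit:
  assumes "reached b s (Suc k) j h u fam w q rest \<psi>"
    and fits: "h > 0" "Suc k * alpha a b \<le> u" "Suc k \<le> gcd a b" "Suc k * beta a b \<le> s"
  shows "reached b s (Suc k) (Suc j) (h - 1) (u - Suc k * alpha a b) fam
    (w * h * (gcd a b choose Suc k)) (q * Suc j) rest (\<psi>((b, s, Suc k) := Suc j))"
proof -
  let ?\<psi>' = "\<psi>((b, s, Suc k) := Suc j)"
  note r = assms(1)[unfolded reached_def]
  have bs: "(b, s) \<in> rows" "Suc k \<le> r" and j: "\<psi> (b, s, Suc k) = j" and z: "\<psi> (b, s, 0) = 0"
    and row: "(\<Sum>i\<le>r. \<psi> (b, s, i)) + h = h\<^sub>0 (b, s)" and u: "u + cost rows \<psi> = r"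
    using r by auto
  have sup: "(b, s) \<in> supp h\<^sub>0"
    using row fits by (auto simp: supp_def)
  then have "b \<ge> 1" using supp_remaining supp_H by blast
  \<comment> \<open>The budget equation gives \<open>u \<le> r\<close>, so a unit that fits into the
    unspent budget also respects the bound by \<open>r\<close> in \<open>K_max\<close>.\<close>
  then have "Suc k \<le> K_max a r b s"
    unfolding le_K_max_iff[OF a_pos \<open>b \<ge> 1\<close>] using fits u by linarith
  then have "admissible ?\<psi>'"
    using r sup by (auto simp: admissible_def)
  moreover have "(\<Sum>i\<le>r. ?\<psi>' (b, s, i)) = Suc (\<Sum>i\<le>r. \<psi> (b, s, i))"
    using sum_row_Suc[OF bs(2), of \<psi> b s 1] j by simp
  moreover have "cost rows ?\<psi>' = cost rows \<psi> + Suc k * alpha a b"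
    using cost_Suc[OF bs, of \<psi> 1] j by simp
  moreover have "fraction ?\<psi>' (w * h * (gcd a b choose Suc k)) (q * Suc j)"
    using fraction_Suc[OF _ bs(1) _ z row fits(1), of w q "Suc k"] r bs(2) j by auto
  moreover have "(\<Sum>i\<le>r. ?\<psi>' (b', s', i)) = h\<^sub>0 (b', s')"
    if "(b', s') \<in> rows - insert (b, s) (fst ` set rest)" for b' s'
    using r sum_row_other[of b' s' b s \<psi> "Suc k" "Suc j"] that by auto
  moreover have "?\<psi>'((b, s, Suc k) := 0) = \<psi>((b, s, Suc k) := 0)" "?\<psi>' (b, s, Suc k) = Suc j"
    "\<forall>i < Suc k. ?\<psi>' (b, s, i) = 0"
    using r by auto
  moreover have "\<forall>(b', s') \<in> fst ` set rest. \<forall>i. ?\<psi>' (b', s', i) = 0"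
    using r by (intro rest_zero_update) blast+
  ultimately show ?thesis
    using r fits unfolding reached_def by (auto simp del: fun_upd_apply)
qed

text \<open>A completion has either more than \<open>j\<close> units at the current level or exactly
  \<open>j\<close>. These cases match the two branches of the search; their disjointness prevents a
  transition from being listed twice.\<close>

lemma completions_Suc:
  assumes "reached b s (Suc k) j h u fam w q rest \<psi>"
  shows "completions b s (Suc k) rest \<psi> =
      completions b s (Suc k) rest (\<psi>((b, s, Suc k) := Suc j)) \<union> completions b s k rest \<psi>"
    and "completions b s (Suc k) rest (\<psi>((b, s, Suc k) := Suc j)) \<inter> completions b s k rest \<psi> = {}"
proof -
  note r = assms[unfolded reached_def]
  have j: "\<psi> (b, s, Suc k) = j" "\<psi> (b, s, k) = 0" "(b, s) \<notin> fst ` set rest" using r by auto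
  let ?\<psi>' = "\<psi>((b, s, Suc k) := Suc j)"
  define agree :: "family \<Rightarrow> family \<Rightarrow> nat \<Rightarrow> bool" where
    "agree = (\<lambda>\<nu> \<psi> k. \<forall>b' s' i. (b', s') \<notin> fst ` set rest \<and> ((b', s') = (b, s) \<longrightarrow> i > k) \<longrightarrow>
      \<nu> (b', s', i) = \<psi> (b', s', i))"
  have level: "agree \<nu> \<psi> k \<longleftrightarrow> agree \<nu> \<psi> (Suc k) \<and> \<nu> (b, s, Suc k) = j" for \<nu>
  proof
    assume *: "agree \<nu> \<psi> (Suc k) \<and> \<nu> (b, s, Suc k) = j"
    show "agree \<nu> \<psi> k"
      unfolding agree_def
    proof (intro allI impI)
      fix b' s' i
      assume "(b', s') \<notin> fst ` set rest \<and> ((b', s') = (b, s) \<longrightarrow> i > k)"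
      with * j show "\<nu> (b', s', i) = \<psi> (b', s', i)"
        unfolding agree_def by (cases "(b', s', i) = (b, s, Suc k)") (auto dest: Suc_lessI)
    qed
  qed (use j in \<open>auto simp: agree_def\<close>)
  have unit: "agree \<nu> ?\<psi>' (Suc k) \<longleftrightarrow> agree \<nu> \<psi> (Suc k)" for \<nu>
    unfolding agree_def by (intro iff_allI imp_cong refl) auto
  have mem: "x \<in> completions b s i rest \<rho> \<longleftrightarrow>
      x \<in> transitions d H a r \<and> agree (snd x) \<rho> i \<and> \<rho> (b, s, i) \<le> snd x (b, s, i)" for x i \<rho>
    by (cases x) (simp add: completions_def agree_def)
  show "completions b s (Suc k) rest \<psi> =
      completions b s (Suc k) rest ?\<psi>' \<union> completions b s k rest \<psi>"
    by (rule set_eqI) (use j in \<open>auto simp: mem level unit\<close>)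
  show "completions b s (Suc k) rest ?\<psi>' \<inter> completions b s k rest \<psi> = {}"
    by (auto simp: mem level)
qed

text \<open>Converse of \<open>reached_unit\<close>: a completion with one more unit dominates the
  enlarged partial family entrywise. Comparing row sums and costs shows that copies and budget
  suffice, and admissibility yields the other two tests. Hence a failed test discards
  nothing.\<close>

lemma unit_fits:
  assumes "reached b s (Suc k) j h u fam w q rest \<psi>"
    and c: "(u', \<nu>) \<in> completions b s (Suc k) rest (\<psi>((b, s, Suc k) := Suc j))"
  shows "h > 0 \<and> Suc k * alpha a b \<le> u \<and> Suc k \<le> gcd a b \<and> Suc k * beta a b \<le> s"
proof -
  let ?\<psi>' = "\<psi>((b, s, Suc k) := Suc j)"
  note r = assms(1)[unfolded reached_def]
  have bs: "(b, s) \<in> rows" "Suc k \<le> r" and j: "\<psi> (b, s, Suc k) = j"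
    and row: "(\<Sum>i\<le>r. \<psi> (b, s, i)) + h = h\<^sub>0 (b, s)" and u: "u + cost rows \<psi> = r"
    using r by auto
  have le: "?\<psi>' (b', s', i) \<le> \<nu> (b', s', i)" for b' s' i
  proof (cases "(b', s') \<notin> fst ` set rest \<and> ((b', s') = (b, s) \<longrightarrow> i > Suc k)")
    case True
    then show ?thesis using c unfolding completions_def by auto
  next
    case False
    then consider "(b', s') \<in> fst ` set rest" | "(b', s') = (b, s)" "i = Suc k"
      | "(b', s') = (b, s)" "i < Suc k" by fastforce
    then show ?thesis using c r by cases (auto simp: completions_def)
  qed
  have t: "admissible \<nu>" "(\<Sum>i\<le>r. \<nu> (b, s, i)) = h\<^sub>0 (b, s)" "u' + cost rows \<nu> = r"
    using c bs by (auto simp: completions_def transitions_rows_iff)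
  have "(\<Sum>i\<le>r. ?\<psi>' (b, s, i)) \<le> (\<Sum>i\<le>r. \<nu> (b, s, i))"
    by (intro sum_mono le)
  moreover have "(\<Sum>i\<le>r. ?\<psi>' (b, s, i)) = Suc (\<Sum>i\<le>r. \<psi> (b, s, i))"
    using sum_row_Suc[OF bs(2), of \<psi> b s 1] j by simp
  ultimately have "h > 0" using t row by linarith
  have "cost rows ?\<psi>' \<le> cost rows \<nu>"
    unfolding cost_def by (intro sum_mono) (auto intro!: sum_mono mult_le_mono2 le simp del: fun_upd_apply)
  moreover have "cost rows ?\<psi>' = cost rows \<psi> + Suc k * alpha a b"
    using cost_Suc[OF bs, of \<psi> 1] j by simp
  ultimately have "Suc k * alpha a b \<le> u" using u t by linarith
  moreover have "\<nu> (b, s, Suc k) \<noteq> 0" using le[of b s "Suc k"] by auto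
  then have "(b, s) \<in> supp h\<^sub>0" "Suc k \<le> K_max a r b s"
    using t(1) by (auto simp: admissible_def)
  moreover from this have "b \<ge> 1" using supp_remaining supp_H by blast
  ultimately show ?thesis
    using \<open>h > 0\<close> le_K_max_iff[OF a_pos \<open>b \<ge> 1\<close>] by auto
qed

section \<open>Correctness of the search\<close>

definition result_of :: "nat \<times> family \<Rightarrow> nat \<times> entry_list \<times> nat \<Rightarrow> bool" where
  "result_of = (\<lambda>(u, \<nu>) (u', fam, w). u' = u \<and> entries fam \<nu> \<and> w = weight H a r u \<nu>)"

lemma search_correct:
  "reached b s k j h u fam w q rest \<psi> \<Longrightarrow>
   \<exists>ts. distinct ts \<and> set ts = completions b s k rest \<psi> \<and>
     list_all2 result_of ts (search a r b s k j h u fam w q rest)"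
proof (induction b s k j h u fam w q rest arbitrary: \<psi> rule: search.induct[where a = a and r = r])
  case (1 b s j h u fam w q)
  let ?\<psi>' = "\<psi>((b, s, 0) := h)"
  note r0 = reached_zero[OF 1]
  have eq: "completions b s 0 [] \<psi> = {(u, ?\<psi>')}"
    using completions_end[OF 1] .
  then have "(u, ?\<psi>') \<in> transitions d H a r"
    by (auto simp: completions_def)
  then have "weight H a r u ?\<psi>' = I_coeff a u * w div q"
    using r0(5) by (intro weight_eq)
  then have "result_of (u, ?\<psi>') (u, push (b, s, 0) h fam, I_coeff a u * w div q)"
    using r0(2) by (simp add: result_of_def)
  with eq show ?case
    by (intro exI[of _ "[(u, ?\<psi>')]"]) simp
next
  case (2 b s j h u fam w q b' s' m rest)
  from 2(1)[OF reached_next_row[OF 2(2)]] show ?case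
    unfolding completions_next_row[OF 2(2)] search.simps .
next
  case (3 b s k j h u fam w q rest)
  let ?fits = "h > 0 \<and> Suc k * alpha a b \<le> u \<and> Suc k \<le> gcd a b \<and> Suc k * beta a b \<le> s"
  let ?T = "completions b s (Suc k) rest (\<psi>((b, s, Suc k) := Suc j))"
  let ?res = "if ?fits then search a r b s (Suc k) (Suc j) (h - 1) (u - Suc k * alpha a b) fam
       (w * h * (gcd a b choose Suc k)) (q * Suc j) rest else []"
  note T = completions_Suc[OF 3(3)]
  have "\<exists>ts. distinct ts \<and> set ts = ?T \<and> list_all2 result_of ts ?res"
  proof (cases ?fits)
    case True
    then have "reached b s (Suc k) (Suc j) (h - 1) (u - Suc k * alpha a b) fam
      (w * h * (gcd a b choose Suc k)) (q * Suc j) rest (\<psi>((b, s, Suc k) := Suc j))"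
      using 3(3) reached_unit by blast
    from 3(1)[OF True this] show ?thesis unfolding if_P[OF True] .
  next
    case False
    then have "?T = {}" using unit_fits[OF 3(3)] by fast
    then show ?thesis unfolding if_not_P[OF False] by (intro exI[of _ "[]"]) simp
  qed
  then obtain ts where ts: "distinct ts" "set ts = ?T" "list_all2 result_of ts ?res" by blast
  from 3(2)[OF reached_next_level[OF 3(3)]] obtain ts' where
    ts': "distinct ts'" "set ts' = completions b s k rest \<psi>"
      "list_all2 result_of ts' (search a r b s k 0 h u (push (b, s, Suc k) j fam) w q rest)"
    by blast
  have "distinct (ts @ ts')" "set (ts @ ts') = completions b s (Suc k) rest \<psi>"
    using ts(1,2) ts'(1,2) T by simp_all
  moreover have "list_all2 result_of (ts @ ts') (search a r b s (Suc k) j h u fam w q rest)"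
    by (subst search.simps(3)) (rule list_all2_appendI[OF ts(3) ts'(3)])
  ultimately show ?case by blast
qed

lemma search_lists_transitions:
  assumes "entries xs H"
  shows "\<exists>ts. distinct ts \<and> set ts = transitions d H a r \<and>
    list_all2 result_of ts (search a r 0 0 0 0 0 r [] 1 1 xs)"
proof -
  have xs: "distinct xs" "set xs = {(x, H x) | x. x \<in> supp H}"
    using assms by (auto simp: entries_def)
  then have fst_xs: "fst ` set xs = supp H" by force
  have inj: "inj_on fst (set xs)" using xs by (auto intro!: inj_onI)
  have z: "(0, 0) \<notin> supp H" "h\<^sub>0 (0, 0) = 0"
    using supp_H[of 0 0] supp_remaining by (auto simp: supp_def)
  have "reached 0 0 0 0 0 r [] 1 1 xs (\<lambda>_. 0)"
    unfolding reached_def fst_xs distinct_map using z xs inj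
    by (auto simp: rows_def admissible_def entries_def supp_def cost_def fraction_def
        unmoved_facts_def moved_def binomials_def moved_facts_def)
  \<comment> \<open>All positions fixed at the start lie outside \<open>supp H\<close>, where every
    transition vanishes, so no transition is excluded.\<close>
  moreover have "completions 0 0 0 xs (\<lambda>_. 0) = transitions d H a r"
  proof -
    have "\<forall>u \<nu> b s k. (u, \<nu>) \<in> transitions d H a r \<longrightarrow> (b, s) \<notin> supp H \<longrightarrow> \<nu> (b, s, k) = 0"
      using supp_remaining by (auto simp: transitions_rows_iff intro: admissible_zero)
    then show ?thesis unfolding completions_def fst_xs by fastforce
  qed
  ultimately show ?thesis using search_correct by metis
qed

end

section \<open>Cost of evaluation\<close>

lemma val_size_Leaf_le:
  assumes "x < 2 ^ L" "L > 0"
  shows "val_size (Leaf x) \<le> L"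
proof (cases "x = 0")
  case False
  then have "2 ^ floor_log x \<le> x" by (simp add: floor_log_exp2_le)
  with assms(1) have "(2::nat) ^ floor_log x < 2 ^ L" by linarith
  then show ?thesis by (simp add: Suc_le_eq)
qed (use assms in simp)

text \<open>If no value exceeds the size \<open>M\<close>, then the cost is at most \<open>M\<close> times the number of steps.\<close>

definition ev :: "program \<Rightarrow> nat \<Rightarrow> val list \<Rightarrow> expr \<Rightarrow> val \<Rightarrow> nat \<Rightarrow> bool" where
  "ev P M \<rho> e v n \<longleftrightarrow> val_size v \<le> M \<and> (\<exists>t \<le> n * M. eval P \<rho> e v t)"

definition evs :: "program \<Rightarrow> nat \<Rightarrow> val list \<Rightarrow> expr list \<Rightarrow> val list \<Rightarrow> nat \<Rightarrow> bool" where
  "evs P M \<rho> es vs n \<longleftrightarrow> (\<exists>t \<le> n * M. evals P \<rho> es vs t)"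

lemma ev_mono: "ev P M \<rho> e v m \<Longrightarrow> v = v' \<Longrightarrow> m \<le> n \<Longrightarrow> ev P M \<rho> e v' n"
  unfolding ev_def by (meson mult_le_mono1 order_trans)

lemma ev_Var: "i < length \<rho> \<Longrightarrow> \<rho> ! i = v \<Longrightarrow> val_size v \<le> M \<Longrightarrow> ev P M \<rho> (Var i) v 1"
  unfolding ev_def using eval_evals.Var[of i \<rho> P] by auto

lemma ev_Lit: "val_size (Leaf x) \<le> M \<Longrightarrow> ev P M \<rho> (Lit x) (Leaf x) 1"
  unfolding ev_def using eval_evals.Lit[of P \<rho> x] by auto

lemma ev_Arith:
  assumes "ev P M \<rho> e1 (Leaf x) m" "ev P M \<rho> e2 (Leaf y) n" "val_size (Leaf (arith_op f x y)) \<le> M"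
  shows "ev P M \<rho> (Arith f e1 e2) (Leaf (arith_op f x y)) (m + n + 1)"
proof -
  obtain t1 t2 where "t1 \<le> m * M" "eval P \<rho> e1 (Leaf x) t1" "t2 \<le> n * M" "eval P \<rho> e2 (Leaf y) t2"
    using assms unfolding ev_def by blast
  with assms(3) eval_evals.Arith[of P \<rho> e1 x t1 e2 y t2 "Leaf (arith_op f x y)" f] show ?thesis
    unfolding ev_def by (intro conjI exI[of _ "t1 + t2 + val_size (Leaf (arith_op f x y))"])
      (simp_all add: algebra_simps)
qed

lemmas ev_Add = ev_Arith[where f = Add, unfolded arith_op.simps]
  and ev_Mul = ev_Arith[where f = Mul, unfolded arith_op.simps]

lemma floor_log_mono_le: "x \<le> y \<Longrightarrow> floor_log x \<le> floor_log y"
  using floor_log_mono by (rule monoD)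

text \<open>Apart from \<open>Add\<close> and \<open>Mul\<close>, no operation returns more than its
  larger operand or the truth value 1. The size bound is then inherited from the operands and only
  sums and products need an estimate.\<close>

lemma ev_shrinking:
  assumes "ev P M \<rho> e1 (Leaf x) m" "ev P M \<rho> e2 (Leaf y) n" "arith_op f x y \<le> max 1 (max x y)"
  shows "ev P M \<rho> (Arith f e1 e2) (Leaf (arith_op f x y)) (m + n + 1)"
proof (rule ev_Arith[OF assms(1,2)])
  show "val_size (Leaf (arith_op f x y)) \<le> M"
  proof (cases "arith_op f x y \<le> 1")
    case True
    then have "floor_log (arith_op f x y) \<le> floor_log 1" by (rule floor_log_mono_le)
    then show ?thesis using assms(1) by (simp add: ev_def)
  next
    case False
    then have "arith_op f x y \<le> x \<or> arith_op f x y \<le> y" using assms(3) by linarith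
    then have "floor_log (arith_op f x y) \<le> floor_log x \<or> floor_log (arith_op f x y) \<le> floor_log y"
      using floor_log_mono_le by blast
    then show ?thesis using assms(1,2) by (auto simp: ev_def)
  qed
qed

lemma ev_Sub: "ev P M \<rho> e1 (Leaf x) m \<Longrightarrow> ev P M \<rho> e2 (Leaf y) n \<Longrightarrow>
    ev P M \<rho> (Arith Sub e1 e2) (Leaf (x - y)) (m + n + 1)"
  using ev_shrinking[where f = Sub] by simp

lemma ev_Div: "ev P M \<rho> e1 (Leaf x) m \<Longrightarrow> ev P M \<rho> e2 (Leaf y) n \<Longrightarrow>
    ev P M \<rho> (Arith Div e1 e2) (Leaf (x div y)) (m + n + 1)"
  using ev_shrinking[where f = Div] by (simp add: le_max_iff_disj)

lemma ev_Mod: "ev P M \<rho> e1 (Leaf x) m \<Longrightarrow> ev P M \<rho> e2 (Leaf y) n \<Longrightarrow>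
    ev P M \<rho> (Arith Mod e1 e2) (Leaf (x mod y)) (m + n + 1)"
  using ev_shrinking[where f = Mod] by (simp add: le_max_iff_disj)

lemma ev_Less: "ev P M \<rho> e1 (Leaf x) m \<Longrightarrow> ev P M \<rho> e2 (Leaf y) n \<Longrightarrow>
    ev P M \<rho> (Arith Less e1 e2) (Leaf (of_bool (x < y))) (m + n + 1)"
  using ev_shrinking[where f = Less] by (simp add: le_max_iff_disj)

lemma ev_Equal: "ev P M \<rho> e1 (Leaf x) m \<Longrightarrow> ev P M \<rho> e2 (Leaf y) n \<Longrightarrow>
    ev P M \<rho> (Arith Equal e1 e2) (Leaf (of_bool (x = y))) (m + n + 1)"
  using ev_shrinking[where f = Equal] by (simp add: le_max_iff_disj)

lemma ev_Join:
  assumes "ev P M \<rho> e1 v m" "ev P M \<rho> e2 w n" "val_size (Node v w) \<le> M"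
  shows "ev P M \<rho> (Join e1 e2) (Node v w) (m + n + 1)"
proof -
  obtain t1 t2 where "t1 \<le> m * M" "eval P \<rho> e1 v t1" "t2 \<le> n * M" "eval P \<rho> e2 w t2"
    using assms unfolding ev_def by blast
  with assms(3) eval_evals.Join[of P \<rho> e1 v t1 e2 w t2] show ?thesis
    unfolding ev_def by (intro conjI exI[of _ "t1 + t2 + val_size (Node v w)"])
      (simp_all add: algebra_simps)
qed

lemma ev_First:
  assumes "ev P M \<rho> e (Node v w) m"
  shows "ev P M \<rho> (First e) v (m + 1)"
proof -
  obtain t where "t \<le> m * M" "eval P \<rho> e (Node v w) t" "val_size (Node v w) \<le> M"
    using assms unfolding ev_def by blast
  with eval_evals.First[of P \<rho> e v w t] show ?thesis
    unfolding ev_def by (intro conjI exI[of _ "t + val_size v"]) (simp_all add: algebra_simps)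
qed

lemma ev_Second:
  assumes "ev P M \<rho> e (Node v w) m"
  shows "ev P M \<rho> (Second e) w (m + 1)"
proof -
  obtain t where "t \<le> m * M" "eval P \<rho> e (Node v w) t" "val_size (Node v w) \<le> M"
    using assms unfolding ev_def by blast
  with eval_evals.Second[of P \<rho> e v w t] show ?thesis
    unfolding ev_def by (intro conjI exI[of _ "t + val_size w"]) (simp_all add: algebra_simps)
qed

lemma ev_Is_Node:
  assumes "ev P M \<rho> e v m"
  shows "ev P M \<rho> (Is_Node e) (Leaf (of_bool (\<exists>v1 v2. v = Node v1 v2))) (m + 1)"
proof -
  obtain t where t: "t \<le> m * M" "eval P \<rho> e v t" "val_size v \<le> M"
    using assms unfolding ev_def by blast
  \<comment> \<open>Every value has size at least 1, so \<open>M\<close> covers the leaf of size 1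
    produced by this step.\<close>
  have one: "1 \<le> M" using t(3) by (cases v) auto
  then have "t + 1 \<le> (m + 1) * M" using t(1) by simp
  then show ?thesis
    unfolding ev_def using t(2) one eval_evals.Is_Node_Leaf eval_evals.Is_Node_Node
    by (cases v) (fastforce intro!: exI[of _ "t + 1"])+
qed

lemma ev_Cond_True:
  assumes "ev P M \<rho> e1 b l" "b \<noteq> Leaf 0" "ev P M \<rho> e2 v m"
  shows "ev P M \<rho> (Cond e1 e2 e3) v (l + m + 1)"
proof -
  obtain t1 t2 where "t1 \<le> l * M" "eval P \<rho> e1 b t1" "t2 \<le> m * M" "eval P \<rho> e2 v t2" "val_size v \<le> M"
    using assms unfolding ev_def by blast
  with assms(2) eval_evals.Cond_True[of P \<rho> e1 b t1 e2 v t2 e3] show ?thesis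
    unfolding ev_def by (intro conjI exI[of _ "t1 + t2 + val_size v"]) (simp_all add: algebra_simps)
qed

lemma ev_Cond_False:
  assumes "ev P M \<rho> e1 (Leaf 0) l" "ev P M \<rho> e3 v m"
  shows "ev P M \<rho> (Cond e1 e2 e3) v (l + m + 1)"
proof -
  obtain t1 t2 where "t1 \<le> l * M" "eval P \<rho> e1 (Leaf 0) t1" "t2 \<le> m * M" "eval P \<rho> e3 v t2"
    "val_size v \<le> M"
    using assms unfolding ev_def by blast
  with eval_evals.Cond_False[of P \<rho> e1 t1 e3 v t2 e2] show ?thesis
    unfolding ev_def by (intro conjI exI[of _ "t1 + t2 + val_size v"]) (simp_all add: algebra_simps)
qed

lemma ev_Bind:
  assumes "ev P M \<rho> e1 w m" "ev P M (w # \<rho>) e2 v n"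
  shows "ev P M \<rho> (Bind e1 e2) v (m + n + 1)"
proof -
  obtain t1 t2 where "t1 \<le> m * M" "eval P \<rho> e1 w t1" "t2 \<le> n * M" "eval P (w # \<rho>) e2 v t2"
    "val_size v \<le> M"
    using assms unfolding ev_def by blast
  with eval_evals.Bind[of P \<rho> e1 w t1 e2 v t2] show ?thesis
    unfolding ev_def by (intro conjI exI[of _ "t1 + t2 + val_size v"]) (simp_all add: algebra_simps)
qed

lemma ev_Call:
  assumes "evs P M \<rho> es vs m" "f < length P" "ev P M vs (P ! f) v n"
  shows "ev P M \<rho> (Call f es) v (m + n + 1)"
proof -
  obtain t1 t2 where "t1 \<le> m * M" "evals P \<rho> es vs t1" "t2 \<le> n * M" "eval P vs (P ! f) v t2"
    "val_size v \<le> M"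
    using assms unfolding ev_def evs_def by blast
  with assms(2) eval_evals.Call[of P \<rho> es vs t1 f v t2] show ?thesis
    unfolding ev_def by (intro conjI exI[of _ "t1 + t2 + val_size v"]) (simp_all add: algebra_simps)
qed

lemma evs_Nil: "evs P M \<rho> [] [] 0"
  unfolding evs_def using eval_evals.Nil by auto

lemma evs_Cons:
  assumes "ev P M \<rho> e v m" "evs P M \<rho> es vs n"
  shows "evs P M \<rho> (e # es) (v # vs) (m + n)"
proof -
  obtain t1 t2 where "t1 \<le> m * M" "eval P \<rho> e v t1" "t2 \<le> n * M" "evals P \<rho> es vs t2"
    using assms unfolding ev_def evs_def by blast
  with eval_evals.Cons[of P \<rho> e v t1 es vs t2] show ?thesis
    unfolding evs_def by (intro exI[of _ "t1 + t2"]) (simp_all add: algebra_simps)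
qed

lemmas ev_intros = ev_Lit ev_Add ev_Mul ev_Sub ev_Div ev_Mod ev_Less ev_Equal ev_Join ev_First
  ev_Second ev_Is_Node evs_Nil evs_Cons

section \<open>The program and its cost\<close>

definition gcd_body :: expr where
  "gcd_body = Cond (Var 1) (Call 2 [Var 1, Arith Mod (Var 0) (Var 1)]) (Var 0)"

text \<open>One recursive call per unit of the lower argument, where Pascal's rule would need two;
  \<open>binomial_step\<close> justifies the division.\<close>

definition binom_body :: expr where
  "binom_body = Cond (Var 1)
    (Arith Div
      (Arith Mul (Call 3 [Var 0, Arith Sub (Var 1) (Lit 1)])
        (Arith Sub (Var 0) (Arith Sub (Var 1) (Lit 1))))
      (Var 1))
    (Lit 1)"

text \<open>
  The arguments of the search are, in this order, \<open>a\<close>, \<open>r\<close>, \<open>b\<close>, \<open>s\<close>, \<open>k\<close>, \<open>j\<close>, \<open>h\<close>, \<open>u\<close>,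
  \<open>fam\<close>, \<open>w\<close>, \<open>q\<close>, \<open>rest\<close>, and the list of the results found so far.
\<close>

definition push_expr :: "nat \<Rightarrow> expr" where
  "push_expr i = Cond (Var i)
    (Join (Join (Var 2) (Join (Var 3) (Join (Var 4) (Var i)))) (Var 8)) (Var 8)"

definition weight_expr :: expr where
  "weight_expr = Arith Div
    (Arith Mul
      (Arith Mul
        (Arith Sub (Lit 1) (Arith Mul (Arith Mod (Var 0) (Lit 2)) (Arith Mod (Var 7) (Lit 2))))
        (Call 3 [Arith Div (Arith Sub (Var 0) (Lit 1)) (Lit 2), Arith Div (Var 7) (Lit 2)]))
      (Var 9))
    (Var 10)"

definition end_expr :: expr where
  "end_expr = Join (Join (Var 7) (Join (push_expr 6) weight_expr)) (Var 12)"

definition next_row_expr :: expr where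
  "next_row_expr =
    Call 1 [Var 0, Var 1, First (First (Var 11)), First (Second (First (Var 11))), Var 1, Lit 0,
      Arith Sub (Second (Second (First (Var 11))))
        (Arith Mul (Arith Equal (First (First (Var 11))) (Var 0))
          (Arith Equal (First (Second (First (Var 11)))) (Var 1))),
      Var 7, push_expr 6, Var 9, Var 10, Second (Var 11), Var 12]"

definition next_level_expr :: expr where
  "next_level_expr = Call 1 [Var 0, Var 1, Var 2, Var 3, Arith Sub (Var 4) (Lit 1), Lit 0, Var 6,
    Var 7, push_expr 5, Var 9, Var 10, Var 11, Var 12]"

text \<open>In the next two expressions, two values precede the arguments: the gcd and the results of the next level.\<close>

definition unit_call_expr :: expr where
  "unit_call_expr =
    Call 1 [Var 2, Var 3, Var 4, Var 5, Var 6, Arith Add (Var 7) (Lit 1), Arith Sub (Var 8) (Lit 1),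
      Arith Sub (Var 9) (Arith Mul (Var 6) (Arith Div (Var 4) (Var 0))), Var 10,
      Arith Mul (Arith Mul (Var 11) (Var 8)) (Call 3 [Var 0, Var 6]),
      Arith Mul (Var 12) (Arith Add (Var 7) (Lit 1)), Var 13, Var 1]"

definition unit_expr :: expr where
  "unit_expr =
    Cond (Var 8)
      (Cond (Arith Less (Var 9) (Arith Mul (Var 6) (Arith Div (Var 4) (Var 0)))) (Var 1)
        (Cond (Arith Less (Var 0) (Var 6)) (Var 1)
          (Cond (Arith Less (Var 5) (Arith Mul (Var 6) (Arith Div (Var 2) (Var 0)))) (Var 1)
            unit_call_expr)))
      (Var 1)"

text \<open>The next level is searched first and its results become the accumulator of the unit
  branch. This reproduces the order of the append in \<open>search\<close>, and a failed test simply
  returns the accumulator.\<close>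

definition search_body :: expr where
  "search_body =
    Cond (Var 4) (Bind next_level_expr (Bind (Call 2 [Var 1, Var 3]) unit_expr))
      (Cond (Is_Node (Var 11)) next_row_expr end_expr)"

definition main_body :: expr where
  "main_body = Call 1 [Var 0, Var 1, Lit 0, Lit 0, Lit 0, Lit 0, Lit 0, Var 1, Lit 0, Lit 1, Lit 1,
    Var 2, Lit 0]"

definition prog :: program where
  "prog = [main_body, search_body, gcd_body, binom_body]"

lemma prog_nth: "prog ! 0 = main_body" "prog ! 1 = search_body" "prog ! 2 = gcd_body" "prog ! 3 = binom_body"
  and length_prog: "length prog = 4"
  by (simp_all add: prog_def)

text \<open>Each Euclidean round lowers the second argument by at least 1. This linear bound
  suffices because the overhead is measured in \<open>n\<close>, not in the bit length of the
  numbers.\<close>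

lemma ev_gcd:
  assumes "val_size (Leaf x) \<le> M" "val_size (Leaf y) \<le> M"
  shows "ev prog M [Leaf x, Leaf y] gcd_body (Leaf (gcd x y)) (10 * (y + 1))"
  using assms
proof (induction y arbitrary: x rule: less_induct)
  case (less y)
  let ?\<rho> = "[Leaf x, Leaf y]"
  have vars: "ev prog M ?\<rho> (Var 0) (Leaf x) 1" "ev prog M ?\<rho> (Var 1) (Leaf y) 1"
    using less.prems by (rule_tac ev_Var; simp)+
  show ?case
  proof (cases "y = 0")
    case True
    then show ?thesis
      unfolding gcd_body_def using vars
      by (intro ev_mono[OF ev_Cond_False]) auto
  next
    case False
    have args: "evs prog M ?\<rho> [Var 1, Arith Mod (Var 0) (Var 1)] [Leaf y, Leaf (x mod y)] (1 + ((1 + 1 + 1) + 0))"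
      by (intro ev_intros vars)
    have "val_size (Leaf (x mod y)) \<le> M"
      using ev_Mod[OF vars] by (simp add: ev_def)
    then have "ev prog M [Leaf y, Leaf (x mod y)] gcd_body (Leaf (gcd y (x mod y))) (10 * (x mod y + 1))"
      using False less.prems by (intro less.IH) auto
    from ev_Call[OF args _ this[folded prog_nth]] 
    have "ev prog M ?\<rho> (Call 2 [Var 1, Arith Mod (Var 0) (Var 1)]) (Leaf (gcd x y))
      (1 + (1 + 1 + 1 + 0) + 10 * (x mod y + 1) + 1)"
      by (simp add: length_prog gcd_red_nat[of x y])
    moreover have "x mod y + 1 \<le> y" using False by (simp add: Suc_le_eq)
    ultimately show ?thesis
      unfolding gcd_body_def using False
      by (intro ev_mono[OF ev_Cond_True[OF vars(2)]]) auto
  qed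
qed

lemma binomial_step: "(m choose k) * (m - k) div Suc k = m choose Suc k"
  using binomial_absorb_comp[of m k] 
  by (metis Suc_times_binomial_add binomial_absorption mult.commute nonzero_mult_div_cancel_left old.nat.distinct(1))

lemma ev_binom:
  assumes "val_size (Leaf m) \<le> M" "val_size (Leaf k) \<le> M" "\<And>i. val_size (Leaf ((m choose i) * (m - i))) \<le> M"
  shows "ev prog M [Leaf m, Leaf k] binom_body (Leaf (m choose k)) (20 * (k + 1))"
  using assms(2)
proof (induction k)
  case 0
  have "ev prog M [Leaf m, Leaf 0] (Var 1) (Leaf 0) 1"
    using 0 by (rule_tac ev_Var; simp)
  moreover have "ev prog M [Leaf m, Leaf 0] (Lit 1) (Leaf 1) 1"
    using 0 by (rule_tac ev_Lit) simp
  ultimately show ?case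
    unfolding binom_body_def by (intro ev_mono[OF ev_Cond_False]) auto
next
  case (Suc k)
  let ?\<rho> = "[Leaf m, Leaf (Suc k)]"
  have vars: "ev prog M ?\<rho> (Var 0) (Leaf m) 1" "ev prog M ?\<rho> (Var 1) (Leaf (Suc k)) 1"
    using Suc.prems assms(1) by (rule_tac ev_Var; simp)+
  have "val_size (Leaf 1) \<le> M" using Suc.prems by simp
  then have pred: "ev prog M ?\<rho> (Arith Sub (Var 1) (Lit 1)) (Leaf k) (1 + 1 + 1)"
    using ev_Sub[OF vars(2) ev_Lit[of 1 M prog ?\<rho>]] by simp
  then have "val_size (Leaf k) \<le> M" by (simp add: ev_def)
  note IH = Suc.IH[OF this]
  have args: "evs prog M ?\<rho> [Var 0, Arith Sub (Var 1) (Lit 1)] [Leaf m, Leaf k] (1 + ((1 + 1 + 1) + 0))"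
    by (intro ev_intros vars pred)
  have call: "ev prog M ?\<rho> (Call 3 [Var 0, Arith Sub (Var 1) (Lit 1)]) (Leaf (m choose k))
      (1 + (1 + 1 + 1 + 0) + 20 * (k + 1) + 1)"
    by (rule ev_Call[OF args _ IH[folded prog_nth]]) (simp add: length_prog)
  have "ev prog M ?\<rho> (Arith Div (Arith Mul (Call 3 [Var 0, Arith Sub (Var 1) (Lit 1)])
        (Arith Sub (Var 0) (Arith Sub (Var 1) (Lit 1)))) (Var 1)) (Leaf (m choose Suc k))
      ((1 + (1 + 1 + 1 + 0) + 20 * (k + 1) + 1) + (1 + (1 + 1 + 1) + 1) + 1 + 1 + 1)"
    using ev_Div[OF ev_Mul[OF call ev_Sub[OF vars(1) pred] assms(3)] vars(2)]
    unfolding binomial_step .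
  then show ?case
    unfolding binom_body_def by (intro ev_mono[OF ev_Cond_True[OF vars(2)]]) auto
qed

text \<open>The branch that closes a level or a row is always available and ends in a result. The
  cost analysis uses this to charge the steps of a node to some result below it.\<close>

lemma search_nonempty: "search a r b s k j h u fam w q rest \<noteq> []"
  by (induction b s k j h u fam w q rest rule: search.induct[where a = a and r = r]) auto

definition enc_result :: "nat \<times> entry_list \<times> nat \<Rightarrow> val" where
  "enc_result = (\<lambda>(u, fam, w). Node (Leaf u) (Node (enc_family fam) (Leaf w)))"

text \<open>With an accumulator the append of \<open>search\<close> becomes a nested call, so the
  program never concatenates lists.\<close>

definition prepend :: "(nat \<times> entry_list \<times> nat) list \<Rightarrow> val \<Rightarrow> val" where
  "prepend xs acc = foldr (\<lambda>x. Node (enc_result x)) xs acc"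

lemma prepend_simps:
  "prepend [] acc = acc" "prepend (x # xs) acc = Node (enc_result x) (prepend xs acc)"
  "prepend (xs @ ys) acc = prepend xs (prepend ys acc)"
  by (simp_all add: prepend_def)

lemma enc_list_results: "enc_list (map enc_result xs) = prepend xs (Leaf 0)"
  by (induction xs) (simp_all add: prepend_simps)

lemma enc_family_push:
  "enc_family (push (b, s, k) m fam) = (if m = 0 then enc_family fam else
    Node (Node (Leaf b) (Node (Leaf s) (Node (Leaf k) (Leaf m)))) (enc_family fam))"
  by (simp add: push_def enc_family_def)

lemma enc_state_simps:
  "enc_state [] = Leaf 0"
  "enc_state (((b, s), m) # rest) = Node (Node (Leaf b) (Node (Leaf s) (Leaf m))) (enc_state rest)"
  by (simp_all add: enc_state_def)

lemma ev_push:
  assumes "ev P M \<rho> (Var 2) (Leaf b) 1" "ev P M \<rho> (Var 3) (Leaf s) 1" "ev P M \<rho> (Var 4) (Leaf k) 1"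
    "ev P M \<rho> (Var i) (Leaf m) 1" "ev P M \<rho> (Var 8) (enc_family fam) 1"
    "val_size (enc_family (push (b, s, k) m fam)) \<le> M"
  shows "ev P M \<rho> (push_expr i) (enc_family (push (b, s, k) m fam)) 12"
proof (cases "m = 0")
  case True
  with assms(4) have "ev P M \<rho> (Var i) (Leaf 0) 1" by simp
  from ev_Cond_False[OF this assms(5)] show ?thesis
    unfolding push_expr_def by (rule ev_mono) (use True in \<open>simp_all add: enc_family_push\<close>)
next
  case False
  have "ev P M \<rho> (Join (Join (Var 2) (Join (Var 3) (Join (Var 4) (Var i)))) (Var 8))
    (Node (Node (Leaf b) (Node (Leaf s) (Node (Leaf k) (Leaf m)))) (enc_family fam))
    ((1 + (1 + (1 + 1 + 1) + 1) + 1) + 1 + 1)"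
    by (intro ev_Join assms) (use assms(6) False in \<open>simp_all add: enc_family_push\<close>)
  then show ?thesis
    unfolding push_expr_def
    by (intro ev_mono[OF ev_Cond_True[OF assms(4)]]) (use False in \<open>auto simp: enc_family_push\<close>)
qed

text \<open>\<open>L\<close> bounds the size of the numbers other than \<open>M\<close>-sized data,
  \<open>Q\<close> that of an encoded partial family, and \<open>S\<close> the own steps of a search
  node, including a gcd and a binomial coefficient. \<open>F\<close> is a list cell with four
  numbers and four inner nodes; \<open>E\<close> is a list cell with two numbers, a family and three
  inner nodes. \<open>M\<close> must bound every value, the growing list of results included, and is
  fixed only when their number is known.\<close>

locale resources =
  fixes d n a r L F Q E M S :: nat
  assumes a: "1 \<le> a" "a \<le> n" and r: "r \<le> d"
    and L: "L = 2 * n * (d + 1) + d + 2"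
    and F: "F = 4 * L + 4" and E: "E = Q + 2 * L + 3" and M: "E \<le> M"
    and S: "S = 200 + 10 * (n + 1) + 40 * (d + 1)"
begin

lemma leaf: "x < 2 ^ L \<Longrightarrow> val_size (Leaf x) \<le> L"
  by (rule val_size_Leaf_le) (use L in auto)

lemma le_M: "L \<le> M" "Q \<le> M"
  using E M by auto

lemma leaf_M: "x < 2 ^ L \<Longrightarrow> val_size (Leaf x) \<le> M"
  using leaf le_M by fastforce

lemma le_power_leaf: "x \<le> 2 ^ m \<Longrightarrow> m < L \<Longrightarrow> x < (2 :: nat) ^ L"
  by (meson le_less_trans one_less_numeral_iff power_strict_increasing semiring_norm(76))

lemma small_leaf: "x \<le> d * n + d + n \<Longrightarrow> x < 2 ^ L"
proof -
  assume "x \<le> d * n + d + n"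
  also have "\<dots> < L" unfolding L by (simp add: algebra_simps)
  also have "L < 2 ^ L" by (rule less_exp)
  finally show ?thesis .
qed

lemma le_1_leaf: "x \<le> 1 \<Longrightarrow> x < (2 :: nat) ^ L"
  using a by (intro small_leaf) simp

lemma le_two_power: "m \<le> n \<Longrightarrow> m \<le> 2 ^ n"
  by (meson less_exp less_imp_le order_trans)

lemma binomial_le_power: "m \<le> n \<Longrightarrow> (m choose i) \<le> 2 ^ n"
proof (cases "i \<le> m")
  case True
  assume "m \<le> n"
  have "(m choose i) \<le> (\<Sum>i\<le>m. m choose i)"
    using True by (intro member_le_sum) auto
  also have "\<dots> = 2 ^ m" by (rule choose_row_sum)
  also have "\<dots> \<le> 2 ^ n" using \<open>m \<le> n\<close> by simp
  finally show ?thesis .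
qed (simp add: binomial_eq_0)

lemma ev_binom_bounded:
  assumes "m \<le> n" "k \<le> d"
  shows "ev prog M [Leaf m, Leaf k] binom_body (Leaf (m choose k)) (20 * (d + 1))"
proof (rule ev_mono[OF ev_binom])
  show "val_size (Leaf m) \<le> M" "val_size (Leaf k) \<le> M"
    using assms by (intro leaf_M small_leaf; simp)+
  show "val_size (Leaf ((m choose i) * (m - i))) \<le> M" for i
  proof (intro leaf_M le_power_leaf)
    have "(m choose i) * (m - i) \<le> 2 ^ n * 2 ^ n"
      using assms binomial_le_power le_two_power by (intro mult_mono) auto
    then show "(m choose i) * (m - i) \<le> 2 ^ (2 * n)" by (simp add: mult_2 power_add)
  qed (simp add: L)
qed (use assms in auto)

lemma size_push:
  assumes "b \<le> n" "s \<le> d" "k \<le> d" "m \<le> n"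
  shows "val_size (enc_family (push (b, s, k) m fam)) \<le> val_size (enc_family fam) + F"
proof -
  have "val_size (Leaf b) \<le> L" "val_size (Leaf s) \<le> L" "val_size (Leaf k) \<le> L" "val_size (Leaf m) \<le> L"
    using assms by (intro leaf small_leaf; simp)+
  then show ?thesis by (simp add: enc_family_push F)
qed

section \<open>Size bounds maintained along the search\<close>

definition small_rows :: "((nat \<times> nat) \<times> nat) list \<Rightarrow> bool" where
  "small_rows rest \<longleftrightarrow> (\<forall>((b, s), m) \<in> set rest. 1 \<le> b \<and> b \<le> n \<and> s \<le> d \<and> m \<le> n)"

text \<open>The number of positions left: \<open>k + 1\<close> in the current row, counting level 0,
  and \<open>r + 1\<close> in each later row. Together with \<open>u\<close> it bounds the depth of
  the search below a node, since a unit keeps the position but uses budget.\<close>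

definition height :: "nat \<Rightarrow> nat \<Rightarrow> nat" where
  "height k l = k + 1 + (r + 1) * l"

text \<open>A unit uses at least 1 of the budget and multiplies \<open>w\<close> and
  \<open>q\<close> by at most \<open>2 ^ (2 * n)\<close>, so the spent budget \<open>r - u\<close>
  controls both. A family entry is written only when a position is left, so \<open>height\<close>
  pays for its size \<open>F\<close>. The clause on \<open>1 \<le> b\<close> spares the artificial
  row, where \<open>alpha\<close> is 0.\<close>

definition small :: "nat \<Rightarrow> nat \<Rightarrow> nat \<Rightarrow> nat \<Rightarrow> nat \<Rightarrow> nat \<Rightarrow> entry_list \<Rightarrow> nat \<Rightarrow> nat \<Rightarrow>
    ((nat \<times> nat) \<times> nat) list \<Rightarrow> bool" where
  "small b s k j h u fam w q rest \<longleftrightarrow>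
    b \<le> n \<and> s \<le> d \<and> k \<le> r \<and> j + h \<le> n \<and> (h > 0 \<longrightarrow> 1 \<le> b) \<and> u \<le> r \<and>
    w \<le> 2 ^ (2 * n * (r - u)) \<and> q \<le> 2 ^ (2 * n * (r - u)) \<and> small_rows rest \<and>
    val_size (enc_state rest) \<le> M \<and>
    val_size (enc_family fam) + F * height k (length rest) \<le> Q"

text \<open>At most \<open>d\<close> blocks of \<open>2 * n\<close> bits are in use; the
  \<open>d + 1\<close> in \<open>L\<close> reserves one more for an intermediate product such as
  \<open>w * h\<close>, or for \<open>w\<close> times the coefficient at the end.\<close>

lemma power_budget: "x \<le> 2 ^ (2 * n * (r - u)) \<Longrightarrow> y \<le> 2 ^ (2 * n) \<Longrightarrow> x * y < (2 :: nat) ^ L"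
proof (rule le_power_leaf)
  assume "x \<le> 2 ^ (2 * n * (r - u))" "y \<le> 2 ^ (2 * n)"
  then have "x * y \<le> 2 ^ (2 * n * (r - u)) * 2 ^ (2 * n)" by (rule mult_le_mono)
  also have "\<dots> = 2 ^ (2 * n * (r - u + 1))" unfolding power_add[symmetric] by simp
  also have "\<dots> \<le> 2 ^ (2 * n * (d + 1))" using r by (intro power_increasing mult_le_mono2) auto
  finally show "x * y \<le> 2 ^ (2 * n * (d + 1))" .
  show "2 * n * (d + 1) < L" by (simp add: L)
qed

lemma power_budget1: "x \<le> 2 ^ (2 * n * (r - u)) \<Longrightarrow> x < (2 :: nat) ^ L"
  using power_budget[of x u 1] by simp

definition args :: "nat \<Rightarrow> nat \<Rightarrow> nat \<Rightarrow> nat \<Rightarrow> nat \<Rightarrow> nat \<Rightarrow> entry_list \<Rightarrow> nat \<Rightarrow> nat \<Rightarrow>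
    ((nat \<times> nat) \<times> nat) list \<Rightarrow> val \<Rightarrow> val list" where
  "args b s k j h u fam w q rest acc = [Leaf a, Leaf r, Leaf b, Leaf s, Leaf k, Leaf j, Leaf h, Leaf u,
    enc_family fam, Leaf w, Leaf q, enc_state rest, acc]"

lemma args_bounded:
  assumes "small b s k j h u fam w q rest" "val_size acc \<le> M"
  shows "list_all (\<lambda>v. val_size v \<le> M) (args b s k j h u fam w q rest acc)"
proof -
  have "x < 2 ^ L" if "x \<in> {a, r, b, s, k, j, h, u, w, q}" for x
    using that assms(1) a r power_budget1[of w u] power_budget1[of q u] small_leaf[of x]
    unfolding small_def by fastforce
  then have "val_size (Leaf x) \<le> M" if "x \<in> {a, r, b, s, k, j, h, u, w, q}" for x
    using that leaf_M by blast
  moreover have "val_size (enc_family fam) \<le> M"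
    using assms(1) le_M unfolding small_def by linarith
  ultimately show ?thesis
    using assms unfolding args_def small_def by auto
qed

lemma ev_args:
  assumes "small b s k j h u fam w q rest" "val_size acc \<le> M"
  defines "\<rho> \<equiv> args b s k j h u fam w q rest acc"
  shows "ev prog M \<rho> (Var 0) (Leaf a) 1" "ev prog M \<rho> (Var 1) (Leaf r) 1"
    "ev prog M \<rho> (Var 2) (Leaf b) 1" "ev prog M \<rho> (Var 3) (Leaf s) 1"
    "ev prog M \<rho> (Var 4) (Leaf k) 1" "ev prog M \<rho> (Var 5) (Leaf j) 1"
    "ev prog M \<rho> (Var 6) (Leaf h) 1" "ev prog M \<rho> (Var 7) (Leaf u) 1"
    "ev prog M \<rho> (Var 8) (enc_family fam) 1" "ev prog M \<rho> (Var 9) (Leaf w) 1"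
    "ev prog M \<rho> (Var 10) (Leaf q) 1" "ev prog M \<rho> (Var 11) (enc_state rest) 1"
    "ev prog M \<rho> (Var 12) acc 1"
  unfolding \<rho>_def
  using args_bounded[OF assms(1,2)] by (rule_tac ev_Var; simp add: args_def)+

lemma ev_args_shifted:
  assumes "small b s k j h u fam w q rest" "val_size acc \<le> M" "val_size v \<le> M" "val_size v' \<le> M"
  defines "\<rho> \<equiv> v # v' # args b s k j h u fam w q rest acc"
  shows "ev prog M \<rho> (Var 0) v 1" "ev prog M \<rho> (Var 1) v' 1"
    "ev prog M \<rho> (Var 2) (Leaf a) 1" "ev prog M \<rho> (Var 3) (Leaf r) 1"
    "ev prog M \<rho> (Var 4) (Leaf b) 1" "ev prog M \<rho> (Var 5) (Leaf s) 1"
    "ev prog M \<rho> (Var 6) (Leaf k) 1" "ev prog M \<rho> (Var 7) (Leaf j) 1"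
    "ev prog M \<rho> (Var 8) (Leaf h) 1" "ev prog M \<rho> (Var 9) (Leaf u) 1"
    "ev prog M \<rho> (Var 10) (enc_family fam) 1" "ev prog M \<rho> (Var 11) (Leaf w) 1"
    "ev prog M \<rho> (Var 12) (Leaf q) 1" "ev prog M \<rho> (Var 13) (enc_state rest) 1"
  unfolding \<rho>_def
  using args_bounded[OF assms(1,2)] assms(3,4) by (rule_tac ev_Var; simp add: args_def)+

lemma small_next_row:
  assumes "small b s 0 j h u fam w q (((b', s'), m) # rest)"
  shows "small b' s' r 0 (m - of_bool (b' = a \<and> s' = r)) u (push (b, s, 0) h fam) w q rest"
proof -
  have "val_size (enc_family (push (b, s, 0) h fam)) \<le> val_size (enc_family fam) + F"
    using assms by (intro size_push) (auto simp: small_def)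
  then show ?thesis
    using assms by (auto simp: small_def small_rows_def enc_state_simps height_def algebra_simps)
qed

lemma small_next_level:
  assumes "small b s (Suc k) j h u fam w q rest"
  shows "small b s k 0 h u (push (b, s, Suc k) j fam) w q rest"
proof -
  have "val_size (enc_family (push (b, s, Suc k) j fam)) \<le> val_size (enc_family fam) + F"
    using assms r by (intro size_push) (auto simp: small_def)
  then show ?thesis
    using assms by (auto simp: small_def height_def algebra_simps)
qed

lemma small_unit:
  assumes "small b s (Suc k) j h u fam w q rest" "h > 0" "Suc k * alpha a b \<le> u"
  shows "small b s (Suc k) (Suc j) (h - 1) (u - Suc k * alpha a b) fam
    (w * h * (gcd a b choose Suc k)) (q * Suc j) rest"
proof -
  have sm: "b \<ge> 1" "u \<le> r" "j + h \<le> n"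
    "w \<le> 2 ^ (2 * n * (r - u))" "q \<le> 2 ^ (2 * n * (r - u))"
    using assms by (auto simp: small_def)
  have "Suc k * alpha a b \<ge> 1" using alpha_pos[OF sm(1), of a] by simp
  then have "r - u + 1 \<le> r - (u - Suc k * alpha a b)"
    using assms(3) sm(2) by linarith
  then have "2 * n * (r - u + 1) \<le> 2 * n * (r - (u - Suc k * alpha a b))"
    by (rule mult_le_mono2)
  then have "2 * n * (r - u) + 2 * n \<le> 2 * n * (r - (u - Suc k * alpha a b))"
    by (simp only: distrib_left mult_1_right)
  then have pow: "2 ^ (2 * n * (r - u)) * 2 ^ (2 * n) \<le> (2 :: nat) ^ (2 * n * (r - (u - Suc k * alpha a b)))"
    by (simp flip: power_add)
  have "gcd a b \<le> n" using a by (meson dvd_imp_le gcd_dvd1 le_trans less_le_trans zero_less_one)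
  then have "h * (gcd a b choose Suc k) \<le> 2 ^ n * 2 ^ n"
    using binomial_le_power le_two_power sm by (intro mult_le_mono) auto
  then have "w * (h * (gcd a b choose Suc k)) \<le> 2 ^ (2 * n * (r - u)) * 2 ^ (2 * n)"
    using sm by (intro mult_le_mono) (simp_all add: mult_2 power_add)
  with pow have "w * h * (gcd a b choose Suc k) \<le> 2 ^ (2 * n * (r - (u - Suc k * alpha a b)))"
    by (simp add: mult.assoc)
  moreover have "Suc j \<le> 2 ^ (2 * n)"
    using sm assms(2) less_exp[of "2 * n"] by linarith
  then have "q * Suc j \<le> 2 ^ (2 * n * (r - (u - Suc k * alpha a b)))"
    using pow sm by (meson mult_le_mono order_trans)
  ultimately show ?thesis
    using assms unfolding small_def by auto
qed

text \<open>The step bound is depth times number of results: each result pays \<open>S\<close> for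
  every node on its path. The size clause limits the growth of the accumulator and so keeps later
  calls within \<open>M\<close>.\<close>

definition handles :: "nat \<Rightarrow> nat \<Rightarrow> nat \<Rightarrow> nat \<Rightarrow> nat \<Rightarrow> nat \<Rightarrow> entry_list \<Rightarrow> nat \<Rightarrow> nat \<Rightarrow>
    ((nat \<times> nat) \<times> nat) list \<Rightarrow> val \<Rightarrow> bool" where
  "handles b s k j h u fam w q rest acc \<longleftrightarrow>
    (let res = search a r b s k j h u fam w q rest in
      val_size (prepend res acc) \<le> val_size acc + E * length res \<and>
      ev prog M (args b s k j h u fam w q rest acc) search_body (prepend res acc)
        (S * (height k (length rest) + u) * length res))"

lemma handles_end:
  assumes small: "small b s 0 j h u fam w q []"
    and acc: "val_size acc + E \<le> M"
  shows "handles b s 0 j h u fam w q [] acc"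
proof -
  let ?\<rho> = "args b s 0 j h u fam w q [] acc"
  let ?I = "(a - 1) div 2 choose (u div 2)"
  let ?f = "1 - (a mod 2) * (u mod 2)"
  let ?W = "I_coeff a u * w div q"
  have "val_size acc \<le> M" using acc by simp
  note vars = ev_args[OF small this]
  have sm: "u \<le> r" "b \<le> n" "s \<le> d" "h \<le> n" "w \<le> 2 ^ (2 * n * (r - u))"
    using small by (auto simp: small_def)
  have lit: "ev prog M ?\<rho> (Lit x) (Leaf x) 1" if "x \<le> 2" for x
  proof -
    have "(2::nat) ^ 2 \<le> 2 ^ L" unfolding L by (intro power_increasing) auto
    then show ?thesis using that by (intro ev_Lit leaf_M) simp
  qed
  have fam: "val_size (enc_family (push (b, s, 0) h fam)) \<le> Q"
    using size_push[of b s 0 h fam] small sm by (simp add: small_def height_def)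
  have f: "?f \<le> 1" by simp
  have I: "?I \<le> 2 ^ n" using a by (intro binomial_le_power) auto
  have fI: "?f * ?I \<le> 2 ^ n" using mult_le_mono[OF f I] by simp
  also have "(2 :: nat) ^ n \<le> 2 ^ (2 * n)" by simp
  finally have "w * (?f * ?I) < 2 ^ L" by (rule power_budget[OF sm(5)])
  then have fIw: "?f * ?I * w < 2 ^ L" by (simp only: mult.commute)
  have fI': "?f * ?I < 2 ^ L" by (rule le_power_leaf[OF fI]) (simp add: L)
  have div: "ev prog M ?\<rho> (Arith Div (Arith Sub (Var 0) (Lit 1)) (Lit 2)) (Leaf ((a - 1) div 2)) 5"
    "ev prog M ?\<rho> (Arith Div (Var 7) (Lit 2)) (Leaf (u div 2)) 3"
    by (rule ev_mono[OF ev_Div[OF ev_Sub[OF vars(1) lit] lit]];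
        simp) (rule ev_mono[OF ev_Div[OF vars(8) lit]]; simp)
  have es: "evs prog M ?\<rho> [Arith Div (Arith Sub (Var 0) (Lit 1)) (Lit 2), Arith Div (Var 7) (Lit 2)]
      [Leaf ((a - 1) div 2), Leaf (u div 2)] (5 + (3 + 0))"
    by (intro evs_Cons evs_Nil div)
  have "(a - 1) div 2 \<le> n" "u div 2 \<le> d" using a sm r by linarith+
  from ev_binom_bounded[OF this] have body: "ev prog M [Leaf ((a - 1) div 2), Leaf (u div 2)] (prog ! 3) (Leaf ?I) (20 * (d + 1))"
    by (simp add: prog_nth)
  have call: "ev prog M ?\<rho> (Call 3 [Arith Div (Arith Sub (Var 0) (Lit 1)) (Lit 2), Arith Div (Var 7) (Lit 2)])
      (Leaf ?I) (5 + (3 + 0) + 20 * (d + 1) + 1)"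
    by (rule ev_Call[OF es _ body]) (simp add: length_prog)
  have mods: "a mod 2 * (u mod 2) < 2 ^ L"
    using mult_le_mono[of "a mod 2" 1 "u mod 2" 1] by (intro le_1_leaf) simp
  have "ev prog M ?\<rho> weight_expr (Leaf (?f * ?I * w div q))
      (1 + (1 + 1 + 1 + (1 + 1 + 1) + 1) + 1 + (5 + (3 + 0) + 20 * (d + 1) + 1) + 1 + 1 + 1 + 1 + 1)"
    unfolding weight_expr_def
    by (intro ev_Div ev_Mul ev_Sub ev_Mod call vars lit leaf_M fI' fIw mods) simp_all
  then have W: "ev prog M ?\<rho> weight_expr (Leaf ?W) (30 + 20 * (d + 1))"
    by (rule ev_mono) (simp_all add: I_coeff_eq[OF a(1)])
  have "?W < 2 ^ L" using fIw unfolding I_coeff_eq[OF a(1)] by (meson div_le_dividend le_less_trans)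
  then have leafs: "val_size (Leaf ?W) \<le> L" "val_size (Leaf u) \<le> L"
    using small_leaf[of u] sm r by (intro leaf; simp)+
  have P: "ev prog M ?\<rho> (push_expr 6) (enc_family (push (b, s, 0) h fam)) 12"
    using fam le_M by (intro ev_push vars) simp
  let ?res = "Node (Leaf u) (Node (enc_family (push (b, s, 0) h fam)) (Leaf ?W))"
  have size: "val_size (Node ?res acc) \<le> val_size acc + E"
    using leafs fam unfolding E by simp
  have "ev prog M ?\<rho> end_expr (Node ?res acc)
      (1 + (12 + (30 + 20 * (d + 1)) + 1) + 1 + 1 + 1)"
    unfolding end_expr_def
    by (intro ev_Join vars P W) (use size acc in auto)
  moreover have "ev prog M ?\<rho> (Is_Node (Var 11)) (Leaf 0) 2"
    by (rule ev_mono[OF ev_Is_Node[OF vars(12)]]) (simp_all add: enc_state_simps)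
  ultimately have "ev prog M ?\<rho> search_body (Node ?res acc) S"
    unfolding search_body_def
    by (intro ev_mono[OF ev_Cond_False[OF vars(5) ev_Cond_False]]) (auto simp: S)
  then have "ev prog M ?\<rho> search_body (Node ?res acc) (S * (height 0 0 + u) * 1)"
    by (rule ev_mono) (simp_all add: height_def)
  with size show ?thesis
    by (simp add: handles_def prepend_simps enc_result_def)
qed

lemma handles_next_row:
  assumes small: "small b s 0 j h u fam w q (((b', s'), m) # rest)"
    and acc: "val_size acc \<le> M"
    and IH: "handles b' s' r 0 (m - of_bool (b' = a \<and> s' = r)) u (push (b, s, 0) h fam) w q rest acc"
  shows "handles b s 0 j h u fam w q (((b', s'), m) # rest) acc"
proof -
  let ?\<rho> = "args b s 0 j h u fam w q (((b', s'), m) # rest) acc"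
  let ?res = "search a r b' s' r 0 (m - of_bool (b' = a \<and> s' = r)) u (push (b, s, 0) h fam) w q rest"
  note vars = ev_args[OF small acc]
  have row: "ev prog M ?\<rho> (Var 11) (Node (Node (Leaf b') (Node (Leaf s') (Leaf m))) (enc_state rest)) 1"
    using vars(12) by (simp add: enc_state_simps)
  have lit: "ev prog M ?\<rho> (Lit 0) (Leaf 0) 1"
    by (intro ev_Lit leaf_M) simp
  have "val_size (enc_family (push (b, s, 0) h fam)) \<le> M"
    using small_next_row[OF small] le_M by (simp add: small_def)
  then have P: "ev prog M ?\<rho> (push_expr 6) (enc_family (push (b, s, 0) h fam)) 12"
    by (intro ev_push vars)
  have one: "val_size (Leaf (of_bool A * of_bool B)) \<le> M" for A B
    by (intro leaf_M le_1_leaf) simp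
  have parts: "ev prog M ?\<rho> (First (First (Var 11))) (Leaf b') 3"
      "ev prog M ?\<rho> (First (Second (First (Var 11)))) (Leaf s') 4"
      "ev prog M ?\<rho> (Second (Second (First (Var 11)))) (Leaf m) 4"
      "ev prog M ?\<rho> (Second (Var 11)) (enc_state rest) 2"
    using ev_First[OF ev_First[OF row]] ev_First[OF ev_Second[OF ev_First[OF row]]]
      ev_Second[OF ev_Second[OF ev_First[OF row]]] ev_Second[OF row]
    by (simp_all only: one_add_one numeral_plus_one add_num_simps)
  have es: "evs prog M ?\<rho> [Var 0, Var 1, First (First (Var 11)), First (Second (First (Var 11))), Var 1, Lit 0,
      Arith Sub (Second (Second (First (Var 11))))
        (Arith Mul (Arith Equal (First (First (Var 11))) (Var 0))
          (Arith Equal (First (Second (First (Var 11)))) (Var 1))),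
      Var 7, push_expr 6, Var 9, Var 10, Second (Var 11), Var 12]
    [Leaf a, Leaf r, Leaf b', Leaf s', Leaf r, Leaf 0,
      Leaf (m - of_bool (b' = a) * of_bool (s' = r)), Leaf u, enc_family (push (b, s, 0) h fam), Leaf w,
      Leaf q, enc_state rest, acc]
    (1 + (1 + (3 + (4 + (1 + (1 + ((4 + ((3 + 1 + 1) + (4 + 1 + 1) + 1) + 1) +
      (1 + (12 + (1 + (1 + (2 + (1 + 0)))))))))))))"
    by (intro evs_Cons evs_Nil ev_Sub ev_Mul ev_Equal vars lit P parts one)
  have "ev prog M (args b' s' r 0 (m - of_bool (b' = a \<and> s' = r)) u (push (b, s, 0) h fam) w q rest acc)
      (prog ! 1) (prepend ?res acc) (S * (height r (length rest) + u) * length ?res)"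
    unfolding prog_nth using IH unfolding handles_def Let_def by blast
  from ev_Call[OF es[folded of_bool_conj] _ this[unfolded args_def]]
  have "ev prog M ?\<rho> next_row_expr (prepend ?res acc)
    (47 + S * (height r (length rest) + u) * length ?res)"
    unfolding next_row_expr_def by (rule ev_mono) (simp_all add: length_prog)
  moreover have "ev prog M ?\<rho> (Is_Node (Var 11)) (Leaf 1) 2"
    by (rule ev_mono[OF ev_Is_Node[OF vars(12)]]) (simp_all add: enc_state_simps)
  ultimately have body: "ev prog M ?\<rho> search_body (prepend ?res acc)
      (60 + S * (height r (length rest) + u) * length ?res)"
    unfolding search_body_def
    by (intro ev_mono[OF ev_Cond_False[OF vars(5) ev_Cond_True]]) auto
  \<comment> \<open>Entering a row lowers \<open>height\<close> by 1, which frees \<open>S\<close>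
    for each result, and there is at least one; this covers the 60 steps.\<close>
  have "60 \<le> S" "1 \<le> length ?res"
    using search_nonempty by (auto simp: S Suc_le_eq)
  then have "60 \<le> S * length ?res"
    by (metis mult_le_mono nat_mult_1_right)
  then have "60 + S * (height r (length rest) + u) * length ?res
      \<le> S * (height 0 (length (((b', s'), m) # rest)) + u) * length ?res"
    by (simp add: height_def algebra_simps)
  from ev_mono[OF body refl this] IH show ?thesis
    by (simp add: handles_def Let_def)
qed

lemma handles_next_level:
  assumes small: "small b s (Suc k) j h u fam w q rest"
    and acc: "val_size acc + E * length (search a r b s (Suc k) j h u fam w q rest) \<le> M"
    and IH1: "\<And>acc'. h > 0 \<and> Suc k * alpha a b \<le> u \<and> Suc k \<le> gcd a b \<and> Suc k * beta a b \<le> s \<Longrightarrow>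
      val_size acc' + E * length (search a r b s (Suc k) (Suc j) (h - 1) (u - Suc k * alpha a b) fam
        (w * h * (gcd a b choose Suc k)) (q * Suc j) rest) \<le> M \<Longrightarrow>
      handles b s (Suc k) (Suc j) (h - 1) (u - Suc k * alpha a b) fam
        (w * h * (gcd a b choose Suc k)) (q * Suc j) rest acc'"
    and IH2: "val_size acc + E * length (search a r b s k 0 h u (push (b, s, Suc k) j fam) w q rest) \<le> M \<Longrightarrow>
      handles b s k 0 h u (push (b, s, Suc k) j fam) w q rest acc"
  shows "handles b s (Suc k) j h u fam w q rest acc"
proof -
  let ?\<rho> = "args b s (Suc k) j h u fam w q rest acc"
  let ?fits = "h > 0 \<and> Suc k * alpha a b \<le> u \<and> Suc k \<le> gcd a b \<and> Suc k * beta a b \<le> s"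
  define res1 where "res1 = search a r b s k 0 h u (push (b, s, Suc k) j fam) w q rest"
  define unit where "unit = search a r b s (Suc k) (Suc j) (h - 1) (u - Suc k * alpha a b) fam
        (w * h * (gcd a b choose Suc k)) (q * Suc j) rest"
  define res2 where "res2 = (if ?fits then unit else [])"
  define X where "X = S * (height k (length rest) + u)"
  let ?acc1 = "prepend res1 acc"
  have res: "search a r b s (Suc k) j h u fam w q rest = res2 @ res1"
    unfolding res1_def res2_def unit_def by (rule search.simps(3))
  have accM: "val_size acc \<le> M" using acc by simp
  note vars = ev_args[OF small accM]
  have sm: "u \<le> r" "b \<le> n" "s \<le> d" "Suc k \<le> r" "j + h \<le> n" "h > 0 \<Longrightarrow> 1 \<le> b"
    "w \<le> 2 ^ (2 * n * (r - u))" "q \<le> 2 ^ (2 * n * (r - u))"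
    using small by (auto simp: small_def)
  have lit: "ev prog M \<rho> (Lit x) (Leaf x) 1" if "x \<le> 1" for x \<rho>
    using that by (intro ev_Lit leaf_M le_1_leaf)
  have acc1: "val_size acc + E * length res1 \<le> M"
    using acc unfolding res by (simp add: algebra_simps)
  note h1 = IH2[folded res1_def, OF acc1, unfolded handles_def Let_def, folded res1_def X_def]
  have "val_size (enc_family (push (b, s, Suc k) j fam)) \<le> M"
    using small_next_level[OF small] le_M by (simp add: small_def)
  then have P: "ev prog M ?\<rho> (push_expr 5) (enc_family (push (b, s, Suc k) j fam)) 12"
    by (intro ev_push vars)
  have k: "ev prog M ?\<rho> (Arith Sub (Var 4) (Lit 1)) (Leaf k) 3"
    by (rule ev_mono[OF ev_Sub[OF vars(5) lit]]) simp_all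
  have es: "evs prog M ?\<rho> [Var 0, Var 1, Var 2, Var 3, Arith Sub (Var 4) (Lit 1), Lit 0, Var 6,
      Var 7, push_expr 5, Var 9, Var 10, Var 11, Var 12]
    [Leaf a, Leaf r, Leaf b, Leaf s, Leaf k, Leaf 0, Leaf h, Leaf u, enc_family (push (b, s, Suc k) j fam),
      Leaf w, Leaf q, enc_state rest, acc]
    (1 + (1 + (1 + (1 + (3 + (1 + (1 + (1 + (12 + (1 + (1 + (1 + (1 + 0)))))))))))))"
    by (intro evs_Cons evs_Nil vars k P lit) simp
  have "ev prog M (args b s k 0 h u (push (b, s, Suc k) j fam) w q rest acc) (prog ! 1) ?acc1
      (X * length res1)"
    unfolding prog_nth using h1 by blast
  from ev_Call[OF es _ this[unfolded args_def]]
  have level: "ev prog M ?\<rho> next_level_expr ?acc1 (27 + X * length res1)"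
    unfolding next_level_expr_def by (rule ev_mono) (simp_all add: length_prog)

  let ?g = "gcd a b"
  let ?\<rho>1 = "?acc1 # ?\<rho>"
  have acc1M: "val_size ?acc1 \<le> M" using level by (simp add: ev_def)
  have g: "?g \<le> n" using a by (meson dvd_imp_le gcd_dvd1 le_trans less_le_trans zero_less_one)
  then have gM: "val_size (Leaf ?g) \<le> M" by (intro leaf_M small_leaf) simp
  have ab: "val_size (Leaf a) \<le> M" "val_size (Leaf b) \<le> M"
    using vars(1,3) by (simp_all only: ev_def)
  then have v13: "ev prog M ?\<rho>1 (Var 1) (Leaf a) 1" "ev prog M ?\<rho>1 (Var 3) (Leaf b) 1"
    using ab by (rule_tac ev_Var; simp add: args_def)+
  have body: "ev prog M [Leaf a, Leaf b] (prog ! 2) (Leaf ?g) (10 * (b + 1))"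
    unfolding prog_nth using ab by (rule ev_gcd)
  have gcd: "ev prog M ?\<rho>1 (Call 2 [Var 1, Var 3]) (Leaf ?g) (3 + 10 * (n + 1))"
    by (rule ev_mono[OF ev_Call[OF evs_Cons[OF v13(1) evs_Cons[OF v13(2) evs_Nil]] _ body]])
      (use sm(2) in \<open>simp_all add: length_prog\<close>)

  let ?\<rho>2 = "Leaf ?g # ?\<rho>1"
  note vars2 = ev_args_shifted[OF small accM gM acc1M]
  have "alpha a b \<le> n" "beta a b \<le> n"
    using sm(2) a by (auto simp: alpha_def beta_def intro: le_trans[OF div_le_dividend])
  then have "Suc k * alpha a b \<le> d * n" "Suc k * beta a b \<le> d * n"
    using sm(4) r by (auto simp del: mult_Suc intro!: mult_le_mono)
  then have sizes: "val_size (Leaf (Suc k * (b div ?g))) \<le> M" "val_size (Leaf (Suc k * (a div ?g))) \<le> M"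
    unfolding alpha_def beta_def by (intro leaf_M small_leaf; linarith)+
  have prods: "ev prog M ?\<rho>2 (Arith Mul (Var 6) (Arith Div (Var 4) (Var 0))) (Leaf (Suc k * alpha a b)) (1 + (1 + 1 + 1) + 1)"
    "ev prog M ?\<rho>2 (Arith Mul (Var 6) (Arith Div (Var 2) (Var 0))) (Leaf (Suc k * beta a b)) (1 + (1 + 1 + 1) + 1)"
    using ev_Mul[OF vars2(7) ev_Div[OF vars2(5,1)] sizes(1)] ev_Mul[OF vars2(7) ev_Div[OF vars2(3,1)] sizes(2)]
    by (simp_all only: alpha_def beta_def)
  have tests:
    "ev prog M ?\<rho>2 (Arith Less (Var 9) (Arith Mul (Var 6) (Arith Div (Var 4) (Var 0)))) (Leaf (of_bool (u < Suc k * alpha a b))) 7"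
    "ev prog M ?\<rho>2 (Arith Less (Var 0) (Var 6)) (Leaf (of_bool (?g < Suc k))) 3"
    "ev prog M ?\<rho>2 (Arith Less (Var 5) (Arith Mul (Var 6) (Arith Div (Var 2) (Var 0)))) (Leaf (of_bool (s < Suc k * beta a b))) 7"
    by (rule ev_mono[OF ev_Less[OF vars2(10) prods(1)]]; simp)
      ((rule ev_mono[OF ev_Less[OF vars2(1) vars2(7)]]; simp),
       (rule ev_mono[OF ev_Less[OF vars2(6) prods(2)]]; simp))
  have unit: "ev prog M ?\<rho>2 unit_expr (prepend res2 ?acc1) (120 + 20 * (d + 1) + X * length res2)"
  proof (cases ?fits)
    case False
    then have "res2 = []" unfolding res2_def by (rule if_not_P)
    moreover have "ev prog M ?\<rho>2 unit_expr ?acc1 120"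
    proof (cases "h = 0")
      case True
      then show ?thesis
        unfolding unit_expr_def using vars2(9)
        by (intro ev_mono[OF ev_Cond_False[OF _ vars2(2)]]) auto
    next
      case h: False
      consider "u < Suc k * alpha a b" | "\<not> u < Suc k * alpha a b" "?g < Suc k"
        | "\<not> u < Suc k * alpha a b" "\<not> ?g < Suc k" "s < Suc k * beta a b"
        using h False by linarith
      then show ?thesis
      proof cases
        case 1
        show ?thesis
          unfolding unit_expr_def
          by (rule ev_mono[OF ev_Cond_True[OF vars2(9) _ ev_Cond_True[OF tests(1) _ vars2(2)]]])
            (use h 1 in simp_all)
      next
        case 2
        then have t: "ev prog M ?\<rho>2 (Arith Less (Var 9) (Arith Mul (Var 6) (Arith Div (Var 4) (Var 0)))) (Leaf 0) 7"
          using tests(1) by simp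
        show ?thesis
          unfolding unit_expr_def
          by (rule ev_mono[OF ev_Cond_True[OF vars2(9) _ ev_Cond_False[OF t ev_Cond_True[OF tests(2) _ vars2(2)]]]])
            (use h 2 in simp_all)
      next
        case 3
        then have t: "ev prog M ?\<rho>2 (Arith Less (Var 9) (Arith Mul (Var 6) (Arith Div (Var 4) (Var 0)))) (Leaf 0) 7"
          "ev prog M ?\<rho>2 (Arith Less (Var 0) (Var 6)) (Leaf 0) 3"
          using tests(1,2) by simp_all
        show ?thesis
          unfolding unit_expr_def
          by (rule ev_mono[OF ev_Cond_True[OF vars2(9) _ ev_Cond_False[OF t(1)
              ev_Cond_False[OF t(2) ev_Cond_True[OF tests(3) _ vars2(2)]]]]])
            (use h 3 in simp_all)
      qed
    qed
    ultimately show ?thesis by (auto simp: prepend_simps intro: ev_mono)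
  next
    case True
    then have res2: "res2 = unit" unfolding res2_def by (rule if_P)
    \<comment> \<open>The accumulator already holds the results of the next level; reserving
      \<open>E\<close> for every result of both branches leaves room for those of the unit
      branch.\<close>
    have "val_size ?acc1 + E * length unit \<le> M"
      using h1 acc unfolding res res2 by (simp add: algebra_simps)
    note h2 = IH1[folded unit_def, OF True this, unfolded handles_def Let_def, folded unit_def]
    note small' = small_unit[OF small conjunct1[OF True] conjunct1[OF conjunct2[OF True]]]
    have w': "w * h * (?g choose Suc k) < 2 ^ L" "q * Suc j < 2 ^ L"
      using small' power_budget1 unfolding small_def by blast+
    have "h \<le> 2 ^ (2 * n)" using sm(5) less_exp[of "2 * n"] by linarith
    then have wh: "w * h < 2 ^ L" by (rule power_budget[OF sm(7)])
    have body: "ev prog M [Leaf ?g, Leaf (Suc k)] (prog ! 3) (Leaf (?g choose Suc k)) (20 * (d + 1))"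
      unfolding prog_nth using sm(4) r g by (intro ev_binom_bounded) auto
    have binom: "ev prog M ?\<rho>2 (Call 3 [Var 0, Var 6]) (Leaf (?g choose Suc k)) (3 + 20 * (d + 1))"
      by (rule ev_mono[OF ev_Call[OF evs_Cons[OF vars2(1) evs_Cons[OF vars2(7) evs_Nil]] _ body]])
        (simp_all add: length_prog)
    have "val_size (Leaf (Suc j)) \<le> M"
      using sm(5) True by (intro leaf_M small_leaf) simp
    then have j: "ev prog M ?\<rho>2 (Arith Add (Var 7) (Lit 1)) (Leaf (Suc j)) 3"
      by (intro ev_mono[OF ev_Add[OF vars2(8) lit[of 1]]]) simp_all
    have es: "evs prog M ?\<rho>2 [Var 2, Var 3, Var 4, Var 5, Var 6, Arith Add (Var 7) (Lit 1), Arith Sub (Var 8) (Lit 1),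
      Arith Sub (Var 9) (Arith Mul (Var 6) (Arith Div (Var 4) (Var 0))), Var 10,
      Arith Mul (Arith Mul (Var 11) (Var 8)) (Call 3 [Var 0, Var 6]),
      Arith Mul (Var 12) (Arith Add (Var 7) (Lit 1)), Var 13, Var 1]
      [Leaf a, Leaf r, Leaf b, Leaf s, Leaf (Suc k), Leaf (Suc j), Leaf (h - 1), Leaf (u - Suc k * alpha a b),
       enc_family fam, Leaf (w * h * (?g choose Suc k)), Leaf (q * Suc j), enc_state rest, ?acc1]
      (1 + (1 + (1 + (1 + (1 + (3 + ((1 + 1 + 1) + ((1 + (1 + (1 + 1 + 1) + 1) + 1) + (1 +
        ((1 + 1 + 1 + (3 + 20 * (d + 1)) + 1) + ((1 + 3 + 1) + (1 + (1 + 0)))))))))))))"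
      by (intro evs_Cons evs_Nil ev_Sub ev_Mul[where x = "w * h"] ev_Mul[where x = w] ev_Mul[where x = q]
          prods vars2 j binom lit leaf_M w' wh) simp
    have "ev prog M (args b s (Suc k) (Suc j) (h - 1) (u - Suc k * alpha a b) fam
        (w * h * (?g choose Suc k)) (q * Suc j) rest ?acc1) (prog ! 1) (prepend unit ?acc1)
        (S * (height (Suc k) (length rest) + (u - Suc k * alpha a b)) * length unit)"
      unfolding prog_nth using h2 by blast
    from ev_Call[OF es _ this[unfolded args_def]]
    have call: "ev prog M ?\<rho>2 unit_call_expr (prepend unit ?acc1)
        (60 + 20 * (d + 1) + S * (height (Suc k) (length rest) + (u - Suc k * alpha a b)) * length unit)"
      unfolding unit_call_expr_def by (rule ev_mono) (simp_all add: length_prog)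
    \<comment> \<open>A unit keeps the level but lowers the budget by at least 1, so both branches
      obey the same rate \<open>X\<close> per result, which is one \<open>S\<close> below the rate
      of the node itself.\<close>
    have "1 \<le> Suc k * alpha a b" using alpha_pos[of b a] sm(6) True by simp
    then have "height (Suc k) (length rest) + (u - Suc k * alpha a b) \<le> height k (length rest) + u"
      using True unfolding height_def by linarith
    then have "S * (height (Suc k) (length rest) + (u - Suc k * alpha a b)) * length unit \<le> X * length unit"
      unfolding X_def by (intro mult_le_mono) auto
    then have call': "ev prog M ?\<rho>2 unit_call_expr (prepend unit ?acc1)
        (60 + 20 * (d + 1) + X * length unit)"
      by (intro ev_mono[OF call refl] add_left_mono)
    have t:
      "ev prog M ?\<rho>2 (Arith Less (Var 9) (Arith Mul (Var 6) (Arith Div (Var 4) (Var 0)))) (Leaf 0) 7"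
      "ev prog M ?\<rho>2 (Arith Less (Var 0) (Var 6)) (Leaf 0) 3"
      "ev prog M ?\<rho>2 (Arith Less (Var 5) (Arith Mul (Var 6) (Arith Div (Var 2) (Var 0)))) (Leaf 0) 7"
      using tests True by (simp_all add: not_less del: mult_Suc)
    show ?thesis
      unfolding unit_expr_def res2
      by (intro ev_mono[OF ev_Cond_True[OF vars2(9) _ ev_Cond_False[OF t(1)
              ev_Cond_False[OF t(2) ev_Cond_False[OF t(3) call']]]]]) (use True in simp_all)
  qed
  have body: "ev prog M ?\<rho> search_body (prepend (res2 @ res1) acc)
    (1 + ((27 + X * length res1) + ((3 + 10 * (n + 1)) + (120 + 20 * (d + 1) + X * length res2) + 1) + 1) + 1)"
    unfolding search_body_def prepend_simps(3)
    by (intro ev_Cond_True[OF vars(5)] ev_Bind[OF level ev_Bind[OF gcd unit]]) simp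
  \<comment> \<open>The \<open>S\<close> saved per result pays for this node, as the next level
    always returns a result.\<close>
  have "1 \<le> length res1" using search_nonempty by (simp add: res1_def Suc_le_eq)
  then have "S \<le> S * length (res2 @ res1)" by simp
  moreover have "S * (height (Suc k) (length rest) + u) * length (res2 @ res1) =
      S * length (res2 @ res1) + X * length res1 + X * length res2"
    by (simp add: X_def height_def algebra_simps)
  ultimately have bound: "1 + ((27 + X * length res1) + ((3 + 10 * (n + 1)) + (120 + 20 * (d + 1) + X * length res2) + 1) + 1) + 1
    \<le> S * (height (Suc k) (length rest) + u) * length (res2 @ res1)"
    using S by linarith
  have "val_size (prepend (res2 @ res1) acc) \<le> val_size acc + E * length (res2 @ res1)"
  proof (cases ?fits)
    case True
    then have res2: "res2 = unit" unfolding res2_def by (rule if_P)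
    have "val_size ?acc1 + E * length unit \<le> M"
      using h1 acc unfolding res res2 by (simp add: algebra_simps)
    note h2 = IH1[folded unit_def, OF True this, unfolded handles_def Let_def, folded unit_def]
    then show ?thesis using h1 by (simp add: res2 prepend_simps algebra_simps)
  next
    case False
    then have "res2 = []" unfolding res2_def by (rule if_not_P)
    then show ?thesis using h1 by simp
  qed
  then show ?thesis
    unfolding handles_def Let_def res using ev_mono[OF body refl bound] by blast
qed

lemma handles_search:
  "small b s k j h u fam w q rest \<Longrightarrow>
    val_size acc + E * length (search a r b s k j h u fam w q rest) \<le> M \<Longrightarrow>
    handles b s k j h u fam w q rest acc"
proof (induction b s k j h u fam w q rest arbitrary: acc rule: search.induct[where a = a and r = r])
  case 1
  then show ?case by (intro handles_end) simp_all
next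
  case (2 b s j h u fam w q b' s' m rest)
  note acc = 2(3)[unfolded search.simps(2)]
  then have "val_size acc \<le> M" by simp
  from handles_next_row[OF 2(2) this 2(1)[OF small_next_row[OF 2(2)] acc]] show ?case .
next
  case (3 b s k j h u fam w q rest)
  show ?case
    using 3(3,4) by (rule handles_next_level) (blast intro: 3(1,2) small_unit[OF 3(3)] small_next_level[OF 3(3)])+
qed

lemma ev_main:
  assumes rows: "small_rows xs" "length xs \<le> n"
    and Q: "1 + F * (1 + (d + 1) * n) \<le> Q"
    and M': "E * (length (search a r 0 0 0 0 0 r [] 1 1 xs) + 1) \<le> M"
  defines "res \<equiv> search a r 0 0 0 0 0 r [] 1 1 xs"
  shows "ev prog M [Leaf a, Leaf r, enc_state xs] main_body (prepend res (Leaf 0))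
    (S * (1 + (d + 1) * n + d) * length res + 20)"
proof -
  have "val_size (enc_state xs) \<le> 1 + F * length xs"
    using rows(1)
  proof (induction xs)
    case (Cons x xs)
    obtain b s m where x: "x = ((b, s), m)" by (metis surj_pair)
    then have "b \<le> n" "s \<le> d" "m \<le> n" using Cons.prems by (auto simp: small_rows_def)
    then have "val_size (Leaf b) \<le> L" "val_size (Leaf s) \<le> L" "val_size (Leaf m) \<le> L"
      by (intro leaf small_leaf; simp)+
    moreover have "val_size (enc_state xs) \<le> 1 + F * length xs"
      using Cons by (simp add: small_rows_def)
    ultimately show ?case by (simp add: x enc_state_simps F)
  qed (simp add: enc_state_simps)
  also have "length xs \<le> 1 + (d + 1) * n"
    using rows(2) by simp
  then have "1 + F * length xs \<le> 1 + F * (1 + (d + 1) * n)"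
    by (intro add_left_mono mult_le_mono2)
  finally have xsM: "val_size (enc_state xs) \<le> M"
    using Q le_M by linarith
  have "height 0 (length xs) \<le> 1 + (d + 1) * n"
    unfolding height_def using rows(2) r by (simp add: mult_le_mono del: mult_Suc)
  then have fuel: "F * height 0 (length xs) \<le> F * (1 + (d + 1) * n)"
    "S * (height 0 (length xs) + r) \<le> S * (1 + (d + 1) * n + d)"
    using r by (intro mult_le_mono; simp)+
  then have small: "small 0 0 0 0 0 r [] 1 1 xs"
    using rows xsM Q by (simp add: small_def enc_family_def)
  \<comment> \<open>The \<open>+ 1\<close> in the assumption on \<open>M\<close> makes room for the
    initial accumulator \<open>Leaf 0\<close>.\<close>
  have "1 \<le> E" by (simp add: E)
  then have "val_size (Leaf 0) + E * length res \<le> M"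
    using M' unfolding res_def by simp
  from handles_search[OF small this[unfolded res_def]]
  have body: "ev prog M (args 0 0 0 0 0 r [] 1 1 xs (Leaf 0)) (prog ! 1) (prepend res (Leaf 0))
      (S * (height 0 (length xs) + r) * length res)"
    unfolding handles_def Let_def res_def prog_nth by blast
  let ?\<rho> = "[Leaf a, Leaf r, enc_state xs]"
  have "val_size (Leaf a) \<le> M" "val_size (Leaf r) \<le> M"
    using a r by (intro leaf_M small_leaf; simp)+
  then have vars: "ev prog M ?\<rho> (Var 0) (Leaf a) 1" "ev prog M ?\<rho> (Var 1) (Leaf r) 1"
    "ev prog M ?\<rho> (Var 2) (enc_state xs) 1"
    using xsM by (rule_tac ev_Var; simp)+
  have lit: "ev prog M \<rho> (Lit x) (Leaf x) 1" if "x \<le> 1" for x \<rho>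
    using that by (intro ev_Lit leaf_M le_1_leaf)
  have "evs prog M ?\<rho> [Var 0, Var 1, Lit 0, Lit 0, Lit 0, Lit 0, Lit 0, Var 1, Lit 0, Lit 1, Lit 1, Var 2, Lit 0]
      (args 0 0 0 0 0 r [] 1 1 xs (Leaf 0))
      (1 + (1 + (1 + (1 + (1 + (1 + (1 + (1 + (1 + (1 + (1 + (1 + (1 + 0)))))))))))))"
    unfolding args_def enc_family_def list.map enc_list.simps
    by (intro evs_Cons evs_Nil vars lit) simp_all
  from ev_Call[OF this _ body]
  have "ev prog M ?\<rho> main_body (prepend res (Leaf 0)) (S * (height 0 (length xs) + r) * length res + 14)"
    unfolding main_body_def by (rule ev_mono) (simp_all add: length_prog)
  moreover have "S * (height 0 (length xs) + r) * length res \<le> S * (1 + (d + 1) * n + d) * length res"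
    using fuel(2) by (rule mult_le_mono1)
  then have "S * (height 0 (length xs) + r) * length res + 14 \<le> S * (1 + (d + 1) * n + d) * length res + 20"
    by (rule add_mono) simp
  ultimately show ?thesis by (rule ev_mono[OF _ refl])
qed

end

section \<open>The overhead as a polynomial in \<open>n\<close>\<close>

definition polynomial :: "(nat \<Rightarrow> nat) \<Rightarrow> bool" where
  "polynomial f \<longleftrightarrow> (\<exists>p. \<forall>n. f n = poly p n)"

lemma polynomial_intros:
  "polynomial (\<lambda>n. c)" "polynomial (\<lambda>n. n)"
  "polynomial f \<Longrightarrow> polynomial g \<Longrightarrow> polynomial (\<lambda>n. f n + g n)"
  "polynomial f \<Longrightarrow> polynomial g \<Longrightarrow> polynomial (\<lambda>n. f n * g n)"
  "polynomial f \<Longrightarrow> polynomial (\<lambda>n. f n ^ m)"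
proof -
  show "polynomial (\<lambda>n. c)" unfolding polynomial_def by (rule exI[of _ "[:c:]"]) simp
  show "polynomial (\<lambda>n. n)" unfolding polynomial_def by (rule exI[of _ "[:0, 1:]"]) simp
  show "polynomial (\<lambda>n. f n + g n)" if "polynomial f" "polynomial g"
    using that unfolding polynomial_def by (metis poly_add)
  show "polynomial (\<lambda>n. f n * g n)" if "polynomial f" "polynomial g"
    using that unfolding polynomial_def by (metis poly_mult)
  show "polynomial (\<lambda>n. f n ^ m)" if "polynomial f"
    using that unfolding polynomial_def by (metis poly_power)
qed

definition leaf_bound :: "nat \<Rightarrow> nat \<Rightarrow> nat" where
  "leaf_bound d n = 2 * n * (d + 1) + d + 2"

text \<open>One entry for each of the at most \<open>1 + (d + 1) * n\<close> positions of the
  search, plus the leaf that ends the list.\<close>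

definition family_bound :: "nat \<Rightarrow> nat \<Rightarrow> nat" where
  "family_bound d n = 1 + (4 * leaf_bound d n + 4) * (1 + (d + 1) * n)"

definition result_bound :: "nat \<Rightarrow> nat \<Rightarrow> nat" where
  "result_bound d n = family_bound d n + 2 * leaf_bound d n + 3"

definition node_steps :: "nat \<Rightarrow> nat \<Rightarrow> nat" where
  "node_steps d n = 200 + 10 * (n + 1) + 40 * (d + 1)"

text \<open>The first factor counts steps per result. The second bounds the size of any value, the
  output list included; there the bound on the number of transitions enters.\<close>

definition overhead :: "nat \<Rightarrow> nat \<Rightarrow> nat" where
  "overhead d n = (node_steps d n * (1 + (d + 1) * n + d) + 20) *
    (result_bound d n * ((d + 1) ^ d * n ^ d + 1))"

lemma polynomial_overhead: "polynomial (overhead d)"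
  unfolding overhead_def node_steps_def result_bound_def family_bound_def leaf_bound_def
  by (intro polynomial_intros)

lemma runs_prog:
  assumes "normalized d H" "H (a, r) > 0" "active_vertices H \<le> n" "entries xs H"
  shows "\<exists>v t. runs prog [Leaf a, Leaf r, enc_state xs] v t \<and> lists_transitions d H a r v \<and>
    t \<le> overhead d n * card (transitions d H a r)"
proof -
  interpret pivot d H a r by unfold_locales fact+
  define res where "res = search a r 0 0 0 0 0 r [] 1 1 xs"
  obtain ts where ts: "distinct ts" "set ts = transitions d H a r" "list_all2 result_of ts res"
    using search_lists_transitions[OF assms(4)] unfolding res_def by blast
  have len: "length res = card (transitions d H a r)"
    using ts by (metis distinct_card list_all2_lengthD)
  let ?M = "result_bound d n * (length res + 1)"
  have a_le: "a \<le> n"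
    using active_vertices_bounds(2)[OF assms(3), of a r] assms(2) by (simp add: supp_def)
  interpret resources d n a r "leaf_bound d n" "4 * leaf_bound d n + 4" "family_bound d n" "result_bound d n"
    ?M "node_steps d n"
    by (intro resources.intro a_pos a_le r_le refl leaf_bound_def
        result_bound_def node_steps_def) simp
  have xs: "distinct xs" "set xs = {(x, H x) | x. x \<in> supp H}"
    using assms(4) by (auto simp: entries_def)
  have "inj_on fst (set xs)" "fst ` set xs = supp H"
    using xs by (force intro!: inj_onI)+
  then have "length xs = card (supp H)"
    using xs(1) by (metis card_image distinct_card)
  then have "length xs \<le> n" using active_vertices_bounds(1)[OF assms(3)] by simp
  moreover have "small_rows xs"
    unfolding small_rows_def xs(2) using supp_H active_vertices_bounds(2)[OF assms(3)] by auto
  ultimately have "ev prog ?M [Leaf a, Leaf r, enc_state xs] main_body (prepend res (Leaf 0))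
    (node_steps d n * (1 + (d + 1) * n + d) * length res + 20)"
    by (intro ev_main[of xs, folded res_def]) (simp_all add: family_bound_def)
  then obtain t where run: "eval prog [Leaf a, Leaf r, enc_state xs] main_body (prepend res (Leaf 0)) t"
    and t: "t \<le> (node_steps d n * (1 + (d + 1) * n + d) * length res + 20) * ?M"
    unfolding ev_def by blast
  \<comment> \<open>The additive 20 is spread over the results, of which there is at least
    one.\<close>
  have "1 \<le> length res" using search_nonempty by (simp add: res_def Suc_le_eq)
  then have "node_steps d n * (1 + (d + 1) * n + d) * length res + 20
      \<le> (node_steps d n * (1 + (d + 1) * n + d) + 20) * length res"
    by (simp add: distrib_right)
  \<comment> \<open>The number of results occurs twice in the bound on \<open>t\<close>. The
    occurrence in \<open>?M\<close> is replaced by its polynomial bound, the other one becomes the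
    factor \<open>card (transitions d H a r)\<close>.\<close>
  moreover have "?M \<le> result_bound d n * ((d + 1) ^ d * n ^ d + 1)"
    unfolding len using card_transitions_le_power[OF assms(3)] by (intro mult_le_mono2) simp
  ultimately have "t \<le> (node_steps d n * (1 + (d + 1) * n + d) + 20) * length res *
      (result_bound d n * ((d + 1) ^ d * n ^ d + 1))"
    using t by (meson mult_le_mono order_trans)
  then have "t \<le> overhead d n * card (transitions d H a r)"
    by (simp only: overhead_def len mult_ac)
  moreover have "list_all2 (represents_transition H a r) ts (map enc_result res)"
    unfolding list_all2_map2 using ts(3)
    by (rule list_all2_mono) (auto simp: represents_transition_def result_of_def enc_result_def)
  then have "lists_transitions d H a r (prepend res (Leaf 0))"
    unfolding lists_transitions_def using ts by (metis enc_list_results)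
  moreover have "runs prog [Leaf a, Leaf r, enc_state xs] (prepend res (Leaf 0)) t"
    unfolding runs_def prog_nth using run by (simp add: prog_def)
  ultimately show ?thesis by blast
qed

theorem lemma5p2:
  fixes d :: nat
  assumes "d \<ge> 1"
  shows
    "(\<exists>C :: nat. \<forall>(n :: nat) (H :: state) (a :: nat) (r :: nat).
        normalized d H \<and> H \<noteq> (\<lambda>_. 0) \<and> active_vertices H \<le> n \<and> H (a, r) > 0 \<longrightarrow>
        finite (transitions d H a r) \<and> card (transitions d H a r) \<le> C * n ^ d)
     \<and>
     (\<exists>(P :: program) (p :: nat poly). \<forall>(n :: nat) (H :: state) (a :: nat) (r :: nat) xs.
        normalized d H \<and> H \<noteq> (\<lambda>_. 0) \<and> active_vertices H \<le> n \<and> H (a, r) > 0 \<and> entries xs H \<longrightarrow>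
        (\<exists>v t. runs P [Leaf a, Leaf r, enc_state xs] v t \<and>
               lists_transitions d H a r v \<and>
               t \<le> poly p n * card (transitions d H a r)))"
proof
  show "\<exists>C. \<forall>n H a r. normalized d H \<and> H \<noteq> (\<lambda>_. 0) \<and> active_vertices H \<le> n \<and> H (a, r) > 0 \<longrightarrow>
      finite (transitions d H a r) \<and> card (transitions d H a r) \<le> C * n ^ d"
    using pivot.card_transitions_le pivot.card_transitions_le_power
    by (intro exI[of _ "(d + 1) ^ d"]) (auto simp only: pivot_def)
  obtain p where p: "\<And>n. overhead d n = poly p n"
    using polynomial_overhead unfolding polynomial_def by blast
  show "\<exists>P p. \<forall>n H a r xs. normalized d H \<and> H \<noteq> (\<lambda>_. 0) \<and> active_vertices H \<le> n \<and>
      H (a, r) > 0 \<and> entries xs H \<longrightarrow>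
      (\<exists>v t. runs P [Leaf a, Leaf r, enc_state xs] v t \<and> lists_transitions d H a r v \<and>
        t \<le> poly p n * card (transitions d H a r))"
    by (rule exI[of _ prog], rule exI[of _ p], intro allI impI, elim conjE)
      (rule runs_prog[of d, unfolded p])
qed

end
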